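(* Let $I_3(n)$ be the number of ice model configurations on the generalized two-dimensional Sierpinski gasket $SG_3(n)$ and let $v(SG_3(n))=\frac{7\times 6^n+8}{5}$ be its number of vertices. Then the entropy per site $S_{I,SG_3}=\lim_{n\to\infty}\frac{\ln I_3(n)}{v(SG_3(n))}$ equals $0.576812423363\ldots$ (decimal expansion beginning with these digits, i.e. $0.576812423363\le S_{I,SG_3}<0.576812423364$).
   Context: The generalized Sierpinski gasket graphs $SG_3(n)$ (side length $b=3$), $n\ge 0$, are defined recursively. $SG_3(0)$ is a triangle (three vertices, three edges), drawn as an equilateral triangle with bottom side horizontal, with all three vertices called outmost. $SG_3(n+1)$ is obtained by subdividing a larger equilateral triangle (pointing upward) into nine congruent equilateral triangles of one third the side length, placing a copy of $SG_3(n)$ in each of the six upward-pointing small triangles (arranged in layers of 3, 2 and 1), and identifying all outmost vertices of different copies that coincide as points of the plane. The outmost vertices of $SG_3(n+1)$ are the three corners of the large triangle. $SG_3(n)$ has $3\times 6^n$ edges and $\frac{7\times 6^n+8}{5}$ vertices: the three outmost vertices have degree 2, $(6^n-1)/5$ vertices have degree 6, and $6(6^n-1)/5$ vertices have degree 4. An ice model configuration on $SG_3(n)$ is an assignment of an orientation to every edge such that at every vertex of degree 4 exactly two incident edges point toward the vertex and two point away, and at every vertex of degree 6 exactly three incident edges point toward the vertex and three point away. No condition is imposed at the three outmost vertices. $I_3(n)$ is the number of such configurations (e.g. $I_3(0)=8$). *)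

theory Defs
  imports Complex_Main
begin

text \<open>
  The pair \<open>(x, y)\<close> stands for the point \<open>x e\<^sub>1 + y e\<^sub>2\<close> of the plane, where
  \<open>e\<^sub>1 = (1, 0)\<close> and \<open>e\<^sub>2 = (1/2, sqrt 3 / 2)\<close>. The graph \<open>SG\<^sub>3(n)\<close> is drawn so that its smallest
  triangles have side 1, hence its large triangle has the corners \<open>(0, 0)\<close>, \<open>(3^n, 0)\<close>, \<open>(0, 3^n)\<close>.
  The six upward-pointing small triangles used in the step from \<open>n\<close> to \<open>n + 1\<close> are the translates
  of that triangle by \<open>3^n (i, j)\<close> with \<open>i + j \<le> 2\<close>, where \<open>j\<close> is the layer counted from the
  bottom. Two copies meet only in common outmost vertices, so identifying these
  amounts to taking unions of sets of points and of sets of edges.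
\<close>

type_synonym point = "nat \<times> nat"

definition cells :: "(nat \<times> nat) set" where
  "cells = {(i, j). i + j \<le> 2}"

definition shift :: "nat \<Rightarrow> nat \<times> nat \<Rightarrow> point \<Rightarrow> point" where
  "shift s c p = (s * fst c + fst p, s * snd c + snd p)"

primrec SG3_verts :: "nat \<Rightarrow> point set" where
  "SG3_verts 0 = {(0, 0), (1, 0), (0, 1)}"
| "SG3_verts (Suc n) = (\<Union>c\<in>cells. shift (3 ^ n) c ` SG3_verts n)"

primrec SG3_edges :: "nat \<Rightarrow> point set set" where
  "SG3_edges 0 = {{(0, 0), (1, 0)}, {(1, 0), (0, 1)}, {(0, 0), (0, 1)}}"
| "SG3_edges (Suc n) = (\<Union>c\<in>cells. (\<lambda>e. shift (3 ^ n) c ` e) ` SG3_edges n)"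

definition degree :: "'a set set \<Rightarrow> 'a \<Rightarrow> nat" where
  "degree E v = card {e \<in> E. v \<in> e}"

text \<open>An orientation is the set of its directed edges; \<open>(u, v)\<close> points from \<open>u\<close> to \<open>v\<close>.\<close>

definition is_orientation :: "'a set set \<Rightarrow> ('a \<times> 'a) set \<Rightarrow> bool" where
  "is_orientation E D \<longleftrightarrow>
     (\<forall>u v. (u, v) \<in> D \<longrightarrow> {u, v} \<in> E) \<and>
     (\<forall>u v. {u, v} \<in> E \<longrightarrow> ((u, v) \<in> D \<longleftrightarrow> (v, u) \<notin> D))"

definition in_degree :: "('a \<times> 'a) set \<Rightarrow> 'a \<Rightarrow> nat" where
  "in_degree D v = card {u. (u, v) \<in> D}"

definition out_degree :: "('a \<times> 'a) set \<Rightarrow> 'a \<Rightarrow> nat" where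
  "out_degree D v = card {u. (v, u) \<in> D}"

text \<open>The three outmost vertices have degree 2 and are therefore unconstrained.\<close>

definition ice_configs :: "nat \<Rightarrow> (point \<times> point) set set" where
  "ice_configs n = {D. is_orientation (SG3_edges n) D \<and>
     (\<forall>v\<in>SG3_verts n.
        (degree (SG3_edges n) v = 4 \<longrightarrow> in_degree D v = 2 \<and> out_degree D v = 2) \<and>
        (degree (SG3_edges n) v = 6 \<longrightarrow> in_degree D v = 3 \<and> out_degree D v = 3))}"

definition I3 :: "nat \<Rightarrow> nat" where
  "I3 n = card (ice_configs n)"

end

theory Submission
  imports Defs "HOL-Analysis.Harmonic_Numbers"
begin

text \<open>
  Call the flux of an orientation at a vertex its indegree minus its outdegree. An ice
  configuration is an orientation whose flux vanishes except at the three outmost vertices,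
  where it lies in \<open>{-2, 0, 2}\<close>; the three values add up to 0, so there are seven boundary
  states. A configuration on level \<open>n + 1\<close> consists of six configurations on level \<open>n\<close> whose
  fluxes cancel at the seven shared corners. The fluxes of the three corner copies towards one side
  neighbour each determine everything else, which leaves a sum over 27 triples. By
  induction the number of configurations with boundary state \<open>(0, 0, 0)\<close> is some \<open>x\<close>,
  with any of the six other states it is some \<open>y\<close>, and the pair \<open>(x, y)\<close> follows a polynomial recursion
  of degree 6 starting from \<open>(2, 1)\<close>.

  Since \<open>y / x\<close> tends to 0 superexponentially, \<open>x\<close> is almost raised to the sixth
  power in each step: \<open>ln x / 6^n\<close> increases, and from \<open>n = 3\<close> on by a negligible amount. The
  entropy is therefore \<open>5 / 7\<close> of its value at \<open>n = 3\<close>, up to an error below \<open>10^-15\<close>.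
\<close>

section \<open>Orientations glued from pieces\<close>

definition orientations :: "'a set set \<Rightarrow> ('a \<times> 'a) set set" where
  "orientations E = {D. is_orientation E D}"

definition simple_edges :: "'a set set \<Rightarrow> bool" where
  "simple_edges E \<longleftrightarrow> finite E \<and> (\<forall>e\<in>E. \<exists>u v. u \<noteq> v \<and> e = {u, v})"

text \<open>The degree for \<open>k = 1\<close>, the flux for \<open>k = -1\<close>; both are additive over pieces.\<close>

definition wdeg :: "int \<Rightarrow> ('a \<times> 'a) set \<Rightarrow> 'a \<Rightarrow> int" where
  "wdeg k D v = int (in_degree D v) + k * int (out_degree D v)"

text \<open>The maps \<open>\<sigma> c\<close> may send vertices of different pieces to the same
  point; the identification of outmost vertices is carried by these maps alone.\<close>

definition glue :: "'i set \<Rightarrow> ('i \<Rightarrow> 'a \<Rightarrow> 'b) \<Rightarrow> ('i \<Rightarrow> ('a \<times> 'a) set) \<Rightarrow> ('b \<times> 'b) set" where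
  "glue I \<sigma> f = (\<Union>c\<in>I. map_prod (\<sigma> c) (\<sigma> c) ` f c)"

lemma orientation_edge:
  assumes "D \<in> orientations E" "(u, v) \<in> D"
  shows "{u, v} \<in> E"
  using assms by (auto simp: orientations_def is_orientation_def)

lemma simple_edges_finite_Union: "simple_edges E \<Longrightarrow> finite (\<Union>E)"
  unfolding simple_edges_def by (rule finite_Union) auto

lemma orientation_subset: "D \<in> orientations E \<Longrightarrow> D \<subseteq> \<Union>E \<times> \<Union>E"
  by (auto dest!: orientation_edge)

lemma orientation_finite: "simple_edges E \<Longrightarrow> D \<in> orientations E \<Longrightarrow> finite D"
  by (rule finite_subset[OF orientation_subset]) (auto intro!: finite_cartesian_product simple_edges_finite_Union)

lemma finite_orientations:
  assumes "simple_edges E"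
  shows "finite (orientations E)"
proof (rule finite_subset)
  show "orientations E \<subseteq> Pow (\<Union>E \<times> \<Union>E)" using orientation_subset by blast
  show "finite (Pow (\<Union>E \<times> \<Union>E))"
    using simple_edges_finite_Union[OF assms] by (intro finite_Pow_iff[THEN iffD2] finite_cartesian_product)
qed

lemma finite_in_nbrs: "finite D \<Longrightarrow> finite {u. (u, v) \<in> D}"
  by (rule finite_subset[of _ "fst ` D"]) (auto intro: rev_image_eqI)

lemma finite_out_nbrs: "finite D \<Longrightarrow> finite {u. (v, u) \<in> D}"
  by (rule finite_subset[of _ "snd ` D"]) (auto intro: rev_image_eqI)

text \<open>An edge at \<open>v\<close> amounts to its other end, and an orientation makes each such
  neighbour an in-neighbour or an out-neighbour, never both. This turns the degree tests of
  \<open>ice_configs\<close> into statements about \<open>wdeg 1\<close>.\<close>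

lemma degree_eq_in_out:
  assumes E: "simple_edges E" and D: "D \<in> orientations E"
  shows "degree E v = in_degree D v + out_degree D v"
proof -
  have "bij_betw (\<lambda>u. {u, v}) {u. {u, v} \<in> E} {e \<in> E. v \<in> e}"
    unfolding bij_betw_def
  proof
    show "inj_on (\<lambda>u. {u, v}) {u. {u, v} \<in> E}"
      by (auto simp: inj_on_def doubleton_eq_iff)
    show "(\<lambda>u. {u, v}) ` {u. {u, v} \<in> E} = {e \<in> E. v \<in> e}"
    proof (intro equalityI subsetI)
      fix e assume e: "e \<in> {e \<in> E. v \<in> e}"
      then obtain a b where "e = {a, b}" using E unfolding simple_edges_def by blast
      then have "e = {b, v} \<or> e = {a, v}" using e by fastforce
      then obtain u where "e = {u, v}" by blast
      then show "e \<in> (\<lambda>u. {u, v}) ` {u. {u, v} \<in> E}" using e by auto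
    qed auto
  qed
  then have "degree E v = card {u. {u, v} \<in> E}"
    unfolding degree_def by (rule bij_betw_same_card[symmetric])
  also have "{u. {u, v} \<in> E} = {u. (u, v) \<in> D} \<union> {u. (v, u) \<in> D}"
  proof (intro set_eqI iffI)
    fix u assume "u \<in> {u. {u, v} \<in> E}"
    then show "u \<in> {u. (u, v) \<in> D} \<union> {u. (v, u) \<in> D}"
      using D unfolding orientations_def is_orientation_def by blast
  next
    fix u assume "u \<in> {u. (u, v) \<in> D} \<union> {u. (v, u) \<in> D}"
    then show "u \<in> {u. {u, v} \<in> E}"
      using orientation_edge[OF D, of u v] orientation_edge[OF D, of v u]
      by (simp only: insert_commute[of v u "{}"] Un_iff mem_Collect_eq) blast
  qed
  also have "card \<dots> = in_degree D v + out_degree D v"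
    unfolding in_degree_def out_degree_def
  proof (rule card_Un_disjoint)
    show "finite {u. (u, v) \<in> D}" "finite {u. (v, u) \<in> D}"
      using orientation_finite[OF E D] by (auto intro: finite_in_nbrs finite_out_nbrs)
    show "{u. (u, v) \<in> D} \<inter> {u. (v, u) \<in> D} = {}"
      using D by (auto simp: orientations_def is_orientation_def)
  qed
  finally show ?thesis .
qed

text \<open>As the images of the edge set are disjoint, the edge below a glued arc determines its
  piece, and injectivity then determines the arc inside that piece.\<close>

lemma glue_mem_iff:
  assumes inj: "\<And>c. c \<in> I \<Longrightarrow> inj (\<sigma> c)"
    and disj: "disjoint_family_on (\<lambda>c. (`) (\<sigma> c) ` E) I"
    and f: "\<And>c. c \<in> I \<Longrightarrow> f c \<in> orientations E"
    and c: "c \<in> I" and e: "{a, b} \<in> E"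
  shows "(\<sigma> c a, \<sigma> c b) \<in> glue I \<sigma> f \<longleftrightarrow> (a, b) \<in> f c"
proof
  assume "(\<sigma> c a, \<sigma> c b) \<in> glue I \<sigma> f"
  then obtain c' a' b' where c': "c' \<in> I" "(a', b') \<in> f c'"
    and eq: "\<sigma> c a = \<sigma> c' a'" "\<sigma> c b = \<sigma> c' b'"
    by (auto simp: glue_def)
  have "{a', b'} \<in> E" using f c' orientation_edge by metis
  then have "\<sigma> c' ` {a', b'} \<in> (`) (\<sigma> c') ` E" by blast
  moreover have "\<sigma> c ` {a, b} \<in> (`) (\<sigma> c) ` E" using e by blast
  moreover have "\<sigma> c' ` {a', b'} = \<sigma> c ` {a, b}" using eq by simp
  ultimately have "c = c'"
    using disj c c'(1) unfolding disjoint_family_on_def by (metis disjoint_iff)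
  then show "(a, b) \<in> f c" using eq c' inj[OF c] by (auto dest: injD)
next
  assume "(a, b) \<in> f c"
  then have "map_prod (\<sigma> c) (\<sigma> c) (a, b) \<in> glue I \<sigma> f" using c unfolding glue_def by blast
  then show "(\<sigma> c a, \<sigma> c b) \<in> glue I \<sigma> f" by simp
qed

lemma glue_orientation:
  assumes inj: "\<And>c. c \<in> I \<Longrightarrow> inj (\<sigma> c)"
    and disj: "disjoint_family_on (\<lambda>c. (`) (\<sigma> c) ` E) I"
    and E: "simple_edges E"
    and f: "\<And>c. c \<in> I \<Longrightarrow> f c \<in> orientations E"
  shows "glue I \<sigma> f \<in> orientations (\<Union>c\<in>I. (`) (\<sigma> c) ` E)"
  unfolding orientations_def is_orientation_def mem_Collect_eq
proof (intro conjI allI impI)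
  fix u v assume "(u, v) \<in> glue I \<sigma> f"
  then obtain c a b where "c \<in> I" "(a, b) \<in> f c" "u = \<sigma> c a" "v = \<sigma> c b"
    by (auto simp: glue_def)
  then show "{u, v} \<in> (\<Union>c\<in>I. (`) (\<sigma> c) ` E)"
    using orientation_edge[OF f, of c a b] by (auto intro!: bexI[of _ c] image_eqI[of _ _ "{a, b}"])
next
  fix u v assume "{u, v} \<in> (\<Union>c\<in>I. (`) (\<sigma> c) ` E)"
  then obtain c e where c: "c \<in> I" and e: "e \<in> E" and uv: "{u, v} = \<sigma> c ` e" by auto
  obtain a' b' where "e = {a', b'}" using E e unfolding simple_edges_def by blast
  then obtain a b where ab: "e = {a, b}" "u = \<sigma> c a" "v = \<sigma> c b"
    using uv by (auto simp: doubleton_eq_iff)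
  have "(a, b) \<in> f c \<longleftrightarrow> (b, a) \<notin> f c"
    using f[OF c] e ab(1) by (auto simp: orientations_def is_orientation_def)
  then show "(u, v) \<in> glue I \<sigma> f \<longleftrightarrow> (v, u) \<notin> glue I \<sigma> f"
    using glue_mem_iff[where f = f and \<sigma> = \<sigma> and a = a and b = b, OF inj disj f c]
      glue_mem_iff[where f = f and \<sigma> = \<sigma> and a = b and b = a, OF inj disj f c] e ab
    by (simp add: insert_commute)
qed

text \<open>Orientations obey no condition at vertices, so pieces with disjoint edges are oriented
  independently of each other.\<close>

lemma bij_betw_glue:
  assumes inj: "\<And>c. c \<in> I \<Longrightarrow> inj (\<sigma> c)"
    and disj: "disjoint_family_on (\<lambda>c. (`) (\<sigma> c) ` E) I"
    and E: "simple_edges E"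
  shows "bij_betw (glue I \<sigma>) (PiE I (\<lambda>_. orientations E))
           (orientations (\<Union>c\<in>I. (`) (\<sigma> c) ` E))"
  unfolding bij_betw_def
proof
  show "inj_on (glue I \<sigma>) (PiE I (\<lambda>_. orientations E))"
  proof (rule inj_onI)
    fix f g assume f: "f \<in> PiE I (\<lambda>_. orientations E)" and g: "g \<in> PiE I (\<lambda>_. orientations E)"
      and eq: "glue I \<sigma> f = glue I \<sigma> g"
    show "f = g"
    proof (rule PiE_ext[OF f g])
      fix c assume c: "c \<in> I"
      have fc: "\<And>c. c \<in> I \<Longrightarrow> f c \<in> orientations E" and gc: "\<And>c. c \<in> I \<Longrightarrow> g c \<in> orientations E"
        using f g by auto
      have "(a, b) \<in> f c \<longleftrightarrow> (a, b) \<in> g c" if "{a, b} \<in> E" for a b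
        using glue_mem_iff[where f = f and \<sigma> = \<sigma>, OF inj disj fc c that]
          glue_mem_iff[where f = g and \<sigma> = \<sigma>, OF inj disj gc c that] eq by simp
      then show "f c = g c"
        using orientation_edge[OF fc[OF c]] orientation_edge[OF gc[OF c]] by auto
    qed
  qed
  show "glue I \<sigma> ` PiE I (\<lambda>_. orientations E) = orientations (\<Union>c\<in>I. (`) (\<sigma> c) ` E)"
  proof (intro equalityI subsetI)
    fix D assume "D \<in> glue I \<sigma> ` PiE I (\<lambda>_. orientations E)"
    then show "D \<in> orientations (\<Union>c\<in>I. (`) (\<sigma> c) ` E)"
      using glue_orientation[OF inj disj E] by auto
  next
    fix D assume D: "D \<in> orientations (\<Union>c\<in>I. (`) (\<sigma> c) ` E)"
    \<comment> \<open>The inverse of gluing: restrict \<open>D\<close> to each piece and pull it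
      back. The bounded lambda makes the family extensional, as \<open>PiE\<close> demands.\<close>
    define f where "f = (\<lambda>c\<in>I. {(a, b). {a, b} \<in> E \<and> (\<sigma> c a, \<sigma> c b) \<in> D})"
    have "f c \<in> orientations E" if c: "c \<in> I" for c
      unfolding orientations_def is_orientation_def mem_Collect_eq
    proof (intro conjI allI impI)
      fix u v
      have mem: "(u, v) \<in> f c \<longleftrightarrow> {u, v} \<in> E \<and> (\<sigma> c u, \<sigma> c v) \<in> D" for u v
        using c by (simp add: f_def)
      show "{u, v} \<in> E" if "(u, v) \<in> f c" using that mem by simp
      assume uv: "{u, v} \<in> E"
      then have vu: "{v, u} \<in> E" by (simp only: insert_commute)
      have "\<sigma> c ` {u, v} \<in> (\<Union>c\<in>I. (`) (\<sigma> c) ` E)" using uv c by blast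
      then have "{\<sigma> c u, \<sigma> c v} \<in> (\<Union>c\<in>I. (`) (\<sigma> c) ` E)" by (simp only: image_insert image_empty)
      then have "(\<sigma> c u, \<sigma> c v) \<in> D \<longleftrightarrow> (\<sigma> c v, \<sigma> c u) \<notin> D"
        using D unfolding orientations_def is_orientation_def mem_Collect_eq by blast
      then show "(u, v) \<in> f c \<longleftrightarrow> (v, u) \<notin> f c" using mem uv vu by simp
    qed
    then have "f \<in> PiE I (\<lambda>_. orientations E)" by (auto simp: f_def)
    moreover have "D = glue I \<sigma> f"
    proof (intro equalityI subsetI)
      fix x assume x: "x \<in> D"
      obtain u v where uv: "x = (u, v)" by force
      from orientation_edge[OF D, of u v] x uv
      obtain c e where c: "c \<in> I" and e: "e \<in> E" and ce: "{u, v} = \<sigma> c ` e" by auto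
      obtain a' b' where "e = {a', b'}" using E e unfolding simple_edges_def by blast
      then obtain a b where "e = {a, b}" "u = \<sigma> c a" "v = \<sigma> c b"
        using ce by (auto simp: doubleton_eq_iff)
      then have "(a, b) \<in> f c" "x = map_prod (\<sigma> c) (\<sigma> c) (a, b)"
        using x uv c e by (auto simp: f_def)
      then show "x \<in> glue I \<sigma> f" using c unfolding glue_def by blast
    qed (auto simp: glue_def f_def)
    ultimately show "D \<in> glue I \<sigma> ` PiE I (\<lambda>_. orientations E)" by blast
  qed
qed

section \<open>Additivity of degree and flux under gluing\<close>

lemma wdeg_UN:
  assumes I: "finite I" and fin: "\<And>c. c \<in> I \<Longrightarrow> finite (f c)" and disj: "disjoint_family_on f I"
  shows "wdeg k (\<Union>c\<in>I. f c) v = (\<Sum>c\<in>I. wdeg k (f c) v)"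
proof -
  have "{u. (u, v) \<in> (\<Union>c\<in>I. f c)} = (\<Union>c\<in>I. {u. (u, v) \<in> f c})"
    "{u. (v, u) \<in> (\<Union>c\<in>I. f c)} = (\<Union>c\<in>I. {u. (v, u) \<in> f c})" by auto
  moreover have "card (\<Union>c\<in>I. {u. (u, v) \<in> f c}) = (\<Sum>c\<in>I. card {u. (u, v) \<in> f c})"
    "card (\<Union>c\<in>I. {u. (v, u) \<in> f c}) = (\<Sum>c\<in>I. card {u. (v, u) \<in> f c})"
    by (rule card_UN_disjoint; use I fin disj in
      \<open>auto simp: finite_in_nbrs finite_out_nbrs disjoint_family_on_def\<close>)+
  ultimately show ?thesis
    by (simp add: wdeg_def in_degree_def out_degree_def sum.distrib sum_distrib_left)
qed

lemma wdeg_image: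
  assumes "inj \<sigma>"
  shows "wdeg k (map_prod \<sigma> \<sigma> ` D) (\<sigma> v) = wdeg k D v"
proof -
  have "{u. (u, \<sigma> v) \<in> map_prod \<sigma> \<sigma> ` D} = \<sigma> ` {u. (u, v) \<in> D}"
    "{u. (\<sigma> v, u) \<in> map_prod \<sigma> \<sigma> ` D} = \<sigma> ` {u. (v, u) \<in> D}"
    using assms by (force dest: injD)+
  then show ?thesis
    using assms by (simp add: wdeg_def in_degree_def out_degree_def card_image inj_on_subset)
qed

lemma wdeg_outside: "w \<notin> fst ` D \<union> snd ` D \<Longrightarrow> wdeg k D w = 0"
proof -
  assume "w \<notin> fst ` D \<union> snd ` D"
  then have "{u. (u, w) \<in> D} = {}" "{u. (w, u) \<in> D} = {}" by force+
  then show ?thesis by (simp add: wdeg_def in_degree_def out_degree_def)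
qed

text \<open>Pieces may meet in vertices but share no edge, hence no arc, so no arc at
  \<open>w\<close> is counted twice.\<close>

lemma wdeg_glue:
  assumes I: "finite I" and inj: "\<And>c. c \<in> I \<Longrightarrow> inj (\<sigma> c)"
    and disj: "disjoint_family_on (\<lambda>c. (`) (\<sigma> c) ` E) I"
    and E: "simple_edges E"
    and f: "\<And>c. c \<in> I \<Longrightarrow> f c \<in> orientations E"
  shows "wdeg k (glue I \<sigma> f) w = (\<Sum>c\<in>I. wdeg k (map_prod (\<sigma> c) (\<sigma> c) ` f c) w)"
  unfolding glue_def
proof (rule wdeg_UN[OF I])
  show "finite (map_prod (\<sigma> c) (\<sigma> c) ` f c)" if "c \<in> I" for c
    using orientation_finite[OF E f[OF that]] by simp
  show "disjoint_family_on (\<lambda>c. map_prod (\<sigma> c) (\<sigma> c) ` f c) I"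
    unfolding disjoint_family_on_def
  proof (intro ballI impI, rule ccontr)
    fix c c' assume c: "c \<in> I" "c' \<in> I" "c \<noteq> c'"
      and "map_prod (\<sigma> c) (\<sigma> c) ` f c \<inter> map_prod (\<sigma> c') (\<sigma> c') ` f c' \<noteq> {}"
    then obtain a b a' b' where ab: "(a, b) \<in> f c" "(a', b') \<in> f c'"
      "\<sigma> c a = \<sigma> c' a'" "\<sigma> c b = \<sigma> c' b'" by auto
    have "{a, b} \<in> E" "{a', b'} \<in> E"
      using orientation_edge[OF f[OF c(1)] ab(1)] orientation_edge[OF f[OF c(2)] ab(2)] .
    then have "\<sigma> c ` {a, b} \<in> (`) (\<sigma> c) ` E" "\<sigma> c' ` {a', b'} \<in> (`) (\<sigma> c') ` E"
      by blast+
    moreover have "\<sigma> c' ` {a', b'} = \<sigma> c ` {a, b}" using ab(3,4) by simp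
    ultimately have "\<sigma> c ` {a, b} \<in> (`) (\<sigma> c) ` E \<inter> (`) (\<sigma> c') ` E"
      by (simp only: Int_iff simp_thms)
    then show False using disjoint_family_onD[OF disj c(1,2,3)] by simp
  qed
qed

section \<open>The geometry of the gasket\<close>

definition corners :: "nat \<Rightarrow> point set" where
  "corners n = {(0, 0), (3 ^ n, 0), (0, 3 ^ n)}"

lemma cells_eq: "cells = {(0, 0), (1, 0), (2, 0), (0, 1), (1, 1), (0, 2)}"
proof (rule set_eqI)
  fix c :: "nat \<times> nat"
  obtain i j where c: "c = (i, j)" by force
  have "i + j \<le> 2 \<longleftrightarrow> i = 0 \<and> j = 0 \<or> i = 1 \<and> j = 0 \<or> i = 2 \<and> j = 0 \<or>
      i = 0 \<and> j = 1 \<or> i = 1 \<and> j = 1 \<or> i = 0 \<and> j = 2" by presburger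
  then show "c \<in> cells \<longleftrightarrow> c \<in> {(0, 0), (1, 0), (2, 0), (0, 1), (1, 1), (0, 2)}"
    by (simp add: c cells_def)
qed

lemma finite_cells: "finite cells"
  by (simp add: cells_eq)

lemma shift_simps [simp]: "shift s (i, j) (x, y) = (s * i + x, s * j + y)"
  by (simp add: shift_def)

lemma inj_shift: "inj (shift s c)"
  by (auto simp: inj_def shift_def)

lemma SG3_verts_simplex: "p \<in> SG3_verts n \<Longrightarrow> fst p + snd p \<le> 3 ^ n"
proof (induction n arbitrary: p)
  case (Suc n)
  then obtain c q where c: "c \<in> cells" and q: "q \<in> SG3_verts n" and p: "p = shift (3 ^ n) c q" by auto
  have "3 ^ n * (fst c + snd c) \<le> 3 ^ n * 2"
    using c by (intro mult_le_mono2) (auto simp: cells_def)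
  then show ?case using Suc.IH[OF q] p by (simp add: shift_def algebra_simps)
qed auto

lemma finite_SG3_verts: "finite (SG3_verts n)"
  by (induction n) (auto simp: finite_cells)

lemma corners_subset: "corners n \<subseteq> SG3_verts n"
proof (induction n)
  case (Suc n)
  have "(0, 0) = shift (3 ^ n) (0, 0) (0, 0)"
    "(3 ^ Suc n, 0) = shift (3 ^ n) (2, 0) (3 ^ n, 0)"
    "(0, 3 ^ Suc n) = shift (3 ^ n) (0, 2) (0, 3 ^ n)" by simp_all
  moreover have "{(0, 0), (2, 0), (0, 2)} \<subseteq> cells" by (simp add: cells_eq)
  ultimately show ?case using Suc unfolding corners_def SG3_verts.simps
    by (metis (no_types, lifting) UN_iff image_eqI insert_subset empty_subsetI)
qed (simp add: corners_def)

lemma SG3_edges_ends: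
  "e \<in> SG3_edges n \<Longrightarrow> \<exists>u\<in>SG3_verts n. \<exists>v\<in>SG3_verts n. u \<noteq> v \<and> e = {u, v}"
proof (induction n arbitrary: e)
  case (Suc n)
  then obtain c e' where c: "c \<in> cells" and e': "e' \<in> SG3_edges n" and e: "e = shift (3 ^ n) c ` e'"
    by auto
  obtain u v where uv: "u \<in> SG3_verts n" "v \<in> SG3_verts n" "u \<noteq> v" "e' = {u, v}"
    using Suc.IH[OF e'] by blast
  have "shift (3 ^ n) c u \<noteq> shift (3 ^ n) c v" using uv(3) inj_shift by (metis injD)
  moreover have "shift (3 ^ n) c u \<in> SG3_verts (Suc n)" "shift (3 ^ n) c v \<in> SG3_verts (Suc n)"
    using c uv by auto
  moreover have "e = {shift (3 ^ n) c u, shift (3 ^ n) c v}" using e uv(4) by simp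
  ultimately show ?case by blast
next
  case 0
  then show ?case by auto
qed

lemma simple_SG3_edges: "simple_edges (SG3_edges n)"
proof -
  have "finite (SG3_edges n)" by (induction n) (simp_all add: finite_cells)
  then show ?thesis unfolding simple_edges_def using SG3_edges_ends by blast
qed

section \<open>Overlaps between different copies\<close>

lemma lattice_corner:
  fixes s :: nat
  assumes "x + y \<le> s" "s dvd x" "s dvd y" "s > 0"
  shows "(x, y) \<in> {(0, 0), (s, 0), (0, s)}"
proof (cases "x = 0 \<and> y = 0")
  case False
  then consider "x > 0" | "y > 0" by auto
  then show ?thesis
  proof cases
    case 1
    then have "s \<le> x" using assms dvd_imp_le by blast
    then show ?thesis using assms by auto
  next
    case 2
    then have "s \<le> y" using assms dvd_imp_le by blast
    then show ?thesis using assms by auto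
  qed
qed simp

text \<open>A copy that starts further right is met only where the first coordinate of
  \<open>u\<close> is at least \<open>s\<close>, and the triangle of side \<open>s\<close> has a
  single such point.\<close>

lemma overlap_x:
  assumes "shift s c u = shift s c' v" "fst c < fst c'" "fst u + snd u \<le> s"
  shows "u = (s, 0)"
proof -
  have "s * (fst c + 1) \<le> s * fst c'" using assms(2) by (intro mult_le_mono2) simp
  then have "s \<le> fst u" using assms(1) by (simp add: shift_def)
  then show ?thesis using assms(3) by (cases u) auto
qed

lemma overlap_y:
  assumes "shift s c u = shift s c' v" "snd c < snd c'" "fst u + snd u \<le> s"
  shows "u = (0, s)"
proof -
  have "s * (snd c + 1) \<le> s * snd c'" using assms(2) by (intro mult_le_mono2) simp
  then have "s \<le> snd u" using assms(1) by (simp add: shift_def)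
  then show ?thesis using assms(3) by (cases u) auto
qed

text \<open>Different cells differ in some coordinate, so one of the two preimages is
  \<open>(s, 0)\<close> or \<open>(0, s)\<close>. Shifts change coordinates by multiples of
  \<open>s\<close>, so divisibility by \<open>s\<close> passes to the other preimage, and
  \<open>lattice_corner\<close> applies.\<close>

lemma overlap_corner:
  assumes eq: "shift s c u = shift s c' v" and "c \<noteq> c'" and s: "s > 0"
    and u: "fst u + snd u \<le> s" and v: "fst v + snd v \<le> s"
  shows "u \<in> {(0, 0), (s, 0), (0, s)}"
proof -
  have "u = (s, 0) \<or> v = (s, 0) \<or> u = (0, s) \<or> v = (0, s)"
    using overlap_x[OF eq _ u] overlap_x[OF eq[symmetric] _ v]
      overlap_y[OF eq _ u] overlap_y[OF eq[symmetric] _ v] \<open>c \<noteq> c'\<close>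
    by (metis linorder_neqE_nat prod_eqI)
  then have "(s dvd fst u \<and> s dvd snd u) \<or> (s dvd fst v \<and> s dvd snd v)" by auto
  moreover have "s * fst c + fst u = s * fst c' + fst v" "s * snd c + snd u = s * snd c' + snd v"
    using eq by (simp_all add: shift_def)
  then have "s dvd fst u \<longleftrightarrow> s dvd fst v" "s dvd snd u \<longleftrightarrow> s dvd snd v"
    by (metis dvd_add_right_iff dvd_triv_left)+
  ultimately show ?thesis using lattice_corner[of "fst u" "snd u" s] u s by simp
qed

text \<open>The coordinate and the direction in which the cells differ pick the same corner for both
  common points. Two copies thus meet in at most one point and cannot share an edge.\<close>

lemma overlap_unique:
  assumes eq: "shift s c u = shift s c' v" "shift s c u' = shift s c' v'" and "c \<noteq> c'"
    and u: "fst u + snd u \<le> s" "fst u' + snd u' \<le> s"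
    and v: "fst v + snd v \<le> s" "fst v' + snd v' \<le> s"
  shows "u = u'"
proof -
  have "u = u' \<or> v = v'"
    using overlap_x[OF eq(1) _ u(1)] overlap_x[OF eq(1)[symmetric] _ v(1)]
      overlap_y[OF eq(1) _ u(1)] overlap_y[OF eq(1)[symmetric] _ v(1)]
      overlap_x[OF eq(2) _ u(2)] overlap_x[OF eq(2)[symmetric] _ v(2)]
      overlap_y[OF eq(2) _ u(2)] overlap_y[OF eq(2)[symmetric] _ v(2)] \<open>c \<noteq> c'\<close>
    by (metis linorder_neqE_nat prod_eqI)
  then show ?thesis using eq injD[OF inj_shift] by metis
qed

lemma disjoint_shifted_edges:
  "disjoint_family_on (\<lambda>c. (`) (shift (3 ^ n) c) ` SG3_edges n) cells"
  unfolding disjoint_family_on_def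
proof (intro ballI impI, rule ccontr)
  fix c c' assume "c \<in> cells" "c' \<in> cells" and cc: "c \<noteq> c'"
    and "(`) (shift (3 ^ n) c) ` SG3_edges n \<inter> (`) (shift (3 ^ n) c') ` SG3_edges n \<noteq> {}"
  then obtain e e' where e: "e \<in> SG3_edges n" "e' \<in> SG3_edges n"
    and eq: "shift (3 ^ n) c ` e = shift (3 ^ n) c' ` e'" by auto
  obtain u u' where u: "u \<in> SG3_verts n" "u' \<in> SG3_verts n" "u \<noteq> u'" "e = {u, u'}"
    using SG3_edges_ends[OF e(1)] by blast
  have e'_verts: "w \<in> SG3_verts n" if "w \<in> e'" for w using SG3_edges_ends[OF e(2)] that by auto
  obtain v where v: "v \<in> e'" "shift (3 ^ n) c u = shift (3 ^ n) c' v" using eq u(4) by blast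
  obtain v' where v': "v' \<in> e'" "shift (3 ^ n) c u' = shift (3 ^ n) c' v'" using eq u(4) by blast
  show False
    using overlap_unique[OF v(2) v'(2) cc SG3_verts_simplex[OF u(1)] SG3_verts_simplex[OF u(2)]
        SG3_verts_simplex[OF e'_verts[OF v(1)]] SG3_verts_simplex[OF e'_verts[OF v'(1)]]] u(3)
    by simp
qed

text \<open>The corners of the six copies, in units of their side length.\<close>

definition grid :: "(nat \<times> nat) set" where
  "grid = {(0, 0), (1, 0), (2, 0), (3, 0), (0, 1), (1, 1), (2, 1), (0, 2), (1, 2), (0, 3)}"

lemma inj_scale: "inj (\<lambda>(i, j). (3 ^ n * i, 3 ^ n * j) :: point)"
  by (auto simp: inj_def)

lemma shift_image_corners:
  "shift (3 ^ n) c ` corners n =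
    (\<lambda>(i, j). (3 ^ n * i, 3 ^ n * j)) ` {c, (fst c + 1, snd c), (fst c, snd c + 1)}"
  by (cases c) (simp add: corners_def algebra_simps)

lemma shift_corners:
  "(\<Union>c\<in>cells. shift (3 ^ n) c ` corners n) = (\<lambda>(i, j). (3 ^ n * i, 3 ^ n * j)) ` grid"
proof -
  have "(\<Union>c\<in>cells. shift (3 ^ n) c ` corners n) = (\<lambda>(i, j). (3 ^ n * i, 3 ^ n * j)) `
      (\<Union>c\<in>cells. {c, (fst c + 1, snd c), (fst c, snd c + 1)})"
    by (simp only: image_UN shift_image_corners)
  also have "(\<Union>c\<in>cells. {c, (fst c + 1, snd c), (fst c, snd c + 1)}) = grid"
    unfolding cells_eq grid_def by (simp add: numeral_2_eq_2 numeral_3_eq_3) blast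
  finally show ?thesis .
qed

section \<open>Decomposition of the vertex set and its size\<close>

lemma SG3_verts_Suc:
  "SG3_verts (Suc n) = (\<Union>c\<in>cells. shift (3 ^ n) c ` (SG3_verts n - corners n)) \<union>
     (\<lambda>(i, j). (3 ^ n * i, 3 ^ n * j)) ` grid"
proof -
  have "SG3_verts n = (SG3_verts n - corners n) \<union> corners n" using corners_subset by blast
  then have "SG3_verts (Suc n) = (\<Union>c\<in>cells. shift (3 ^ n) c ` ((SG3_verts n - corners n) \<union> corners n))"
    by simp
  also have "\<dots> = (\<Union>c\<in>cells. shift (3 ^ n) c ` (SG3_verts n - corners n)) \<union>
      (\<Union>c\<in>cells. shift (3 ^ n) c ` corners n)" by blast
  finally show ?thesis unfolding shift_corners .
qed

text \<open>Shifting changes coordinates by multiples of \<open>3 ^ n\<close>, and in a triangle of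
  that side only the corners have both coordinates divisible by \<open>3 ^ n\<close>.\<close>

lemma shift_interior_not_grid:
  assumes "v \<in> SG3_verts n - corners n"
  shows "shift (3 ^ n) c v \<notin> (\<lambda>(i, j). (3 ^ n * i, 3 ^ n * j)) ` A"
proof
  assume "shift (3 ^ n) c v \<in> (\<lambda>(i, j). (3 ^ n * i, 3 ^ n * j)) ` A"
  then obtain i j where "3 ^ n * fst c + fst v = 3 ^ n * i" "3 ^ n * snd c + snd v = 3 ^ n * j"
    by (auto simp: shift_def)
  then have "3 ^ n dvd fst v" "3 ^ n dvd snd v"
    by (metis dvd_add_right_iff dvd_triv_left)+
  then have "v \<in> corners n"
    using lattice_corner[of "fst v" "snd v" "3 ^ n"] SG3_verts_simplex assms
    by (auto simp: corners_def)
  then show False using assms by blast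
qed

lemma corners_Suc_grid: "corners (Suc n) = (\<lambda>(i, j). (3 ^ n * i, 3 ^ n * j)) ` {(0, 0), (3, 0), (0, 3)}"
  by (simp add: corners_def mult.commute)

lemma overlap_interior:
  assumes "u \<in> SG3_verts n - corners n" "v \<in> SG3_verts n"
    and "shift (3 ^ n) c u = shift (3 ^ n) c' v"
  shows "c = c'"
  using overlap_corner[OF assms(3)] assms(1,2) SG3_verts_simplex
  by (force simp: corners_def)

text \<open>Each of the six copies contributes \<open>v - 3\<close> vertices besides its corners,
  and all corners together form the ten points of \<open>grid\<close>:
  \<open>6 (v - 3) + 10 = 6 v - 8\<close>.\<close>

lemma card_SG3_verts_Suc: "card (SG3_verts (Suc n)) + 8 = 6 * card (SG3_verts n)"
proof -
  let ?J = "SG3_verts n - corners n"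
  have J: "card ?J + 3 = card (SG3_verts n)"
  proof -
    have "card (corners n) = 3" by (simp add: corners_def)
    moreover have "card (corners n) \<le> card (SG3_verts n)"
      using card_mono[OF finite_SG3_verts corners_subset] .
    ultimately show ?thesis
      using card_Diff_subset[OF _ corners_subset, of n] by (simp add: corners_def)
  qed
  have "card (\<Union>c\<in>cells. shift (3 ^ n) c ` ?J) = (\<Sum>c\<in>cells. card (shift (3 ^ n) c ` ?J))"
  proof (rule card_UN_disjoint)
    show "\<forall>c\<in>cells. \<forall>c'\<in>cells. c \<noteq> c' \<longrightarrow> shift (3 ^ n) c ` ?J \<inter> shift (3 ^ n) c' ` ?J = {}"
      using overlap_interior by blast
  qed (simp_all add: finite_cells finite_SG3_verts)
  also have "\<dots> = (\<Sum>c\<in>cells. card ?J)"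
    by (intro sum.cong refl card_image) (rule inj_on_subset[OF inj_shift subset_UNIV])
  finally have interior: "card (\<Union>c\<in>cells. shift (3 ^ n) c ` ?J) = 6 * card ?J"
    by (simp add: cells_eq)
  have "card ((\<lambda>(i, j). (3 ^ n * i, 3 ^ n * j)) ` grid) = 10"
    by (subst card_image[OF inj_on_subset[OF inj_scale subset_UNIV]]) (simp add: grid_def)
  moreover have "card (SG3_verts (Suc n)) =
      card (\<Union>c\<in>cells. shift (3 ^ n) c ` ?J) + card ((\<lambda>(i, j). (3 ^ n * i, 3 ^ n * j)) ` grid)"
    unfolding SG3_verts_Suc
  proof (rule card_Un_disjoint)
    show "(\<Union>c\<in>cells. shift (3 ^ n) c ` ?J) \<inter> (\<lambda>(i, j). (3 ^ n * i, 3 ^ n * j)) ` grid = {}"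
      using shift_interior_not_grid by blast
  qed (simp_all add: finite_cells finite_SG3_verts grid_def)
  ultimately show ?thesis using interior J by simp
qed

lemma card_SG3_verts: "real (card (SG3_verts n)) = (7 * 6 ^ n + 8) / 5"
proof (induction n)
  case (Suc n)
  have "real (card (SG3_verts (Suc n))) + 8 = 6 * real (card (SG3_verts n))"
    using arg_cong[OF card_SG3_verts_Suc[of n], of real] by simp
  then show ?case using Suc by (simp add: field_simps)
qed simp

section \<open>Degrees and fluxes of a glued orientation\<close>

lemma SG3_arc_ends:
  assumes "D \<in> orientations (SG3_edges n)" "(u, v) \<in> D"
  shows "u \<in> SG3_verts n" "v \<in> SG3_verts n"
proof -
  obtain a b where "a \<in> SG3_verts n" "b \<in> SG3_verts n" "{u, v} = {a, b}"
    using SG3_edges_ends[OF orientation_edge[OF assms]] by blast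
  then show "u \<in> SG3_verts n" "v \<in> SG3_verts n" by (auto simp: doubleton_eq_iff)
qed

lemma wdeg_shift_outside:
  assumes "D \<in> orientations (SG3_edges n)" "w \<notin> shift s c ` SG3_verts n"
  shows "wdeg k (map_prod (shift s c) (shift s c) ` D) w = 0"
  using assms SG3_arc_ends[OF assms(1)] by (intro wdeg_outside) force

context
  fixes n :: nat and f :: "nat \<times> nat \<Rightarrow> (point \<times> point) set"
  assumes f: "\<And>c. c \<in> cells \<Longrightarrow> f c \<in> orientations (SG3_edges n)"
begin

lemma wdeg_glue_cells:
  "wdeg k (glue cells (shift (3 ^ n)) f) w =
     (\<Sum>c\<in>cells. wdeg k (map_prod (shift (3 ^ n) c) (shift (3 ^ n) c) ` f c) w)"
  by (rule wdeg_glue[OF finite_cells inj_shift disjoint_shifted_edges simple_SG3_edges f])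

text \<open>A vertex that is not a corner of its copy lies in no other copy, so a single summand
  survives.\<close>

lemma wdeg_glue_interior:
  assumes c: "c \<in> cells" and v: "v \<in> SG3_verts n - corners n"
  shows "wdeg k (glue cells (shift (3 ^ n)) f) (shift (3 ^ n) c v) = wdeg k (f c) v"
proof -
  have "wdeg k (map_prod (shift (3 ^ n) c') (shift (3 ^ n) c') ` f c') (shift (3 ^ n) c v) =
      (if c' = c then wdeg k (f c) v else 0)" if "c' \<in> cells" for c'
  proof (cases "c' = c")
    case True
    then show ?thesis by (simp add: wdeg_image[OF inj_shift])
  next
    case False
    then have "shift (3 ^ n) c v \<notin> shift (3 ^ n) c' ` SG3_verts n"
      using overlap_interior[OF v] by blast
    then show ?thesis using wdeg_shift_outside[OF f[OF that]] False by simp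
  qed
  then show ?thesis using c by (simp add: wdeg_glue_cells finite_cells)
qed

lemma wdeg_shift_lattice:
  assumes c: "c \<in> cells"
  shows "wdeg k (map_prod (shift (3 ^ n) c) (shift (3 ^ n) c) ` f c) (3 ^ n * i, 3 ^ n * j) =
     (if c = (i, j) then wdeg k (f c) (0, 0)
      else if (fst c + 1, snd c) = (i, j) then wdeg k (f c) (3 ^ n, 0)
      else if (fst c, snd c + 1) = (i, j) then wdeg k (f c) (0, 3 ^ n) else 0)"
proof -
  have *: "wdeg k (map_prod (shift (3 ^ n) c) (shift (3 ^ n) c) ` f c) (3 ^ n * i, 3 ^ n * j) =
      wdeg k (f c) v" if "(3 ^ n * i, 3 ^ n * j) = shift (3 ^ n) c v" for v
    unfolding that by (rule wdeg_image[OF inj_shift])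
  consider "c = (i, j)" | "(fst c + 1, snd c) = (i, j)" | "(fst c, snd c + 1) = (i, j)"
    | "(i, j) \<notin> {c, (fst c + 1, snd c), (fst c, snd c + 1)}" by auto
  then show ?thesis
  proof cases
    case 4
    have "(3 ^ n * i, 3 ^ n * j) \<notin> shift (3 ^ n) c ` SG3_verts n"
    proof
      assume "(3 ^ n * i, 3 ^ n * j) \<in> shift (3 ^ n) c ` SG3_verts n"
      then obtain v where v: "v \<in> SG3_verts n" "shift (3 ^ n) c v = (3 ^ n * i, 3 ^ n * j)" by force
      have "v \<in> corners n" using shift_interior_not_grid[of v n c "{(i, j)}"] v by auto
      then have "shift (3 ^ n) c v \<in> shift (3 ^ n) c ` corners n" by blast
      then have "(\<lambda>(i, j). (3 ^ n * i, 3 ^ n * j)) (i, j) \<in> (\<lambda>(i, j). (3 ^ n * i, 3 ^ n * j)) `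
          {c, (fst c + 1, snd c), (fst c, snd c + 1)}"
        unfolding v(2) shift_image_corners by simp
      then show False using 4 by (simp only: inj_image_mem_iff[OF inj_scale])
    qed
    then show ?thesis using wdeg_shift_outside[OF f[OF c]] 4 by auto
  qed (use *[of "(0, 0)"] *[of "(3 ^ n, 0)"] *[of "(0, 3 ^ n)"] in
      \<open>cases c; auto simp: algebra_simps\<close>)+
qed

lemma wdeg_glue_lattice:
  "wdeg k (glue cells (shift (3 ^ n)) f) (3 ^ n * i, 3 ^ n * j) = (\<Sum>c\<in>cells.
     (if c = (i, j) then wdeg k (f c) (0, 0)
      else if (fst c + 1, snd c) = (i, j) then wdeg k (f c) (3 ^ n, 0)
      else if (fst c, snd c + 1) = (i, j) then wdeg k (f c) (0, 3 ^ n) else 0))"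
  unfolding wdeg_glue_cells by (intro sum.cong refl wdeg_shift_lattice)

text \<open>\<open>A\<close>, \<open>B\<close>, \<open>C\<close> are the values at the bottom left,
  bottom right and top corner of a copy. Three grid points belong to one copy, six to two copies,
  and the centre \<open>w 1 1\<close> to three.\<close>

lemma wdeg_glue_grid:
  fixes k :: int
  defines "w \<equiv> \<lambda>i j. wdeg k (glue cells (shift (3 ^ n)) f) (3 ^ n * i, 3 ^ n * j)"
    and "A \<equiv> \<lambda>i j. wdeg k (f (i, j)) (0, 0)"
    and "B \<equiv> \<lambda>i j. wdeg k (f (i, j)) (3 ^ n, 0)"
    and "C \<equiv> \<lambda>i j. wdeg k (f (i, j)) (0, 3 ^ n)"
  shows "w 0 0 = A 0 0" "w 3 0 = B 2 0" "w 0 3 = C 0 2"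
    "w 1 0 = B 0 0 + A 1 0" "w 2 0 = B 1 0 + A 2 0"
    "w 0 1 = C 0 0 + A 0 1" "w 0 2 = C 0 1 + A 0 2"
    "w 2 1 = C 2 0 + B 1 1" "w 1 2 = C 1 1 + B 0 2"
    "w 1 1 = C 1 0 + B 0 1 + A 1 1"
  unfolding w_def A_def B_def C_def wdeg_glue_lattice by (simp_all add: cells_eq)

end

section \<open>The eight orientations of the base triangle\<close>

lemma orientations_empty: "orientations {} = {{}}"
  by (auto simp: orientations_def is_orientation_def)

text \<open>Applied three times, this lists the orientations of the triangle explicitly.\<close>

lemma orientations_insert:
  assumes "u \<noteq> v" "{u, v} \<notin> E"
  shows "orientations (insert {u, v} E) =
    insert (u, v) ` orientations E \<union> insert (v, u) ` orientations E"
proof (intro equalityI subsetI)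
  fix D assume "D \<in> orientations (insert {u, v} E)"
  then have D: "\<And>x y. (x, y) \<in> D \<Longrightarrow> {x, y} = {u, v} \<or> {x, y} \<in> E"
    "\<And>x y. {x, y} = {u, v} \<or> {x, y} \<in> E \<Longrightarrow> (x, y) \<in> D \<longleftrightarrow> (y, x) \<notin> D"
    unfolding orientations_def is_orientation_def by auto
  define D' where "D' = D - {(u, v), (v, u)}"
  have "D' \<in> orientations E"
    unfolding orientations_def is_orientation_def mem_Collect_eq
  proof (intro conjI allI impI)
    show "{x, y} \<in> E" if "(x, y) \<in> D'" for x y
      using D(1)[of x y] that by (auto simp: D'_def doubleton_eq_iff)
    show "(x, y) \<in> D' \<longleftrightarrow> (y, x) \<notin> D'" if "{x, y} \<in> E" for x y
    proof -
      have "{x, y} \<noteq> {u, v}" using that assms(2) by auto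
      then show ?thesis using D(2)[of x y] that by (auto simp: D'_def doubleton_eq_iff)
    qed
  qed
  moreover have "D = insert (u, v) D' \<or> D = insert (v, u) D'"
    using D(2)[of u v] by (auto simp: D'_def)
  ultimately show "D \<in> insert (u, v) ` orientations E \<union> insert (v, u) ` orientations E" by blast
next
  have *: "insert (a, b) D' \<in> orientations (insert {u, v} E)"
    if D': "D' \<in> orientations E" and ab: "{a, b} = {u, v}" for D' a b
  proof -
    have no: "(u, v) \<notin> D'" "(v, u) \<notin> D'"
      using orientation_edge[OF D', of u v] orientation_edge[OF D', of v u] assms(2)
      by (auto simp: insert_commute[of v u])
    show ?thesis
      unfolding orientations_def is_orientation_def mem_Collect_eq
    proof (intro conjI allI impI)
      show "{x, y} \<in> insert {u, v} E" if "(x, y) \<in> insert (a, b) D'" for x y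
        using that ab orientation_edge[OF D', of x y] by auto
      show "(x, y) \<in> insert (a, b) D' \<longleftrightarrow> (y, x) \<notin> insert (a, b) D'"
        if "{x, y} \<in> insert {u, v} E" for x y
      proof (cases "{x, y} = {u, v}")
        case True
        then show ?thesis using ab no assms(1) by (auto simp: doubleton_eq_iff)
      next
        case False
        then have "{x, y} \<in> E" using that by simp
        then have "(x, y) \<in> D' \<longleftrightarrow> (y, x) \<notin> D'"
          using D' unfolding orientations_def is_orientation_def by blast
        moreover have "(x, y) \<noteq> (a, b)" "(y, x) \<noteq> (a, b)" using False ab by (auto simp: doubleton_eq_iff)
        ultimately show ?thesis by (simp only: insert_iff simp_thms)
      qed
    qed
  qed
  fix D assume "D \<in> insert (u, v) ` orientations E \<union> insert (v, u) ` orientations E"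
  then show "D \<in> orientations (insert {u, v} E)" using * by (auto simp: insert_commute)
qed

lemma orientations_SG3_0:
  "orientations (SG3_edges 0) =
    (\<lambda>(p, q, r). {p, q, r}) ` ({((1, 0), (0, 0)), ((0, 0), (1, 0))} \<times>
       {((0, 1), (1, 0)), ((1, 0), (0, 1))} \<times> {((0, 1), (0, 0)), ((0, 0), (0, 1))})"
proof -
  have "{(0, 0), (1, 0)} \<notin> {{(1, 0), (0, 1)}, {(0, 0), (0, 1) :: point}}"
    "{(1, 0), (0, 1)} \<notin> {{(0, 0), (0, 1) :: point}}"
    by (auto simp: doubleton_eq_iff)
  then show ?thesis
    by (simp add: orientations_insert orientations_empty image_Un insert_Times_insert)
qed

lemma wdeg_empty: "wdeg k {} w = 0"
  by (simp add: wdeg_def in_degree_def out_degree_def)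

lemma wdeg_insert:
  assumes "finite D" "(u, v) \<notin> D"
  shows "wdeg k (insert (u, v) D) w =
    wdeg k D w + (if w = v then 1 else 0) + (if w = u then k else 0)"
proof -
  have "{x. (x, w) \<in> insert (u, v) D} = (if w = v then insert u {x. (x, w) \<in> D} else {x. (x, w) \<in> D})"
    "{x. (w, x) \<in> insert (u, v) D} = (if w = u then insert v {x. (w, x) \<in> D} else {x. (w, x) \<in> D})"
    by auto
  then show ?thesis
    using assms finite_in_nbrs[OF assms(1)] finite_out_nbrs[OF assms(1)]
    by (cases "u = v") (auto simp: wdeg_def in_degree_def out_degree_def algebra_simps)
qed

section \<open>Fluxes through the outmost vertices\<close>

lemma glue_orientations_Suc:
  "bij_betw (glue cells (shift (3 ^ n))) (PiE cells (\<lambda>_. orientations (SG3_edges n)))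
     (orientations (SG3_edges (Suc n)))"
  using bij_betw_glue[OF inj_shift disjoint_shifted_edges simple_SG3_edges] by simp

lemma orientations_SucE:
  assumes "D \<in> orientations (SG3_edges (Suc n))"
  obtains f where "f \<in> extensional cells" "\<And>c. c \<in> cells \<Longrightarrow> f c \<in> orientations (SG3_edges n)"
    "D = glue cells (shift (3 ^ n)) f"
proof -
  have "D \<in> glue cells (shift (3 ^ n)) ` PiE cells (\<lambda>_. orientations (SG3_edges n))"
    unfolding bij_betw_imp_surj_on[OF glue_orientations_Suc] by (rule assms)
  then show ?thesis
  proof (elim imageE)
    fix f assume "D = glue cells (shift (3 ^ n)) f" "f \<in> PiE cells (\<lambda>_. orientations (SG3_edges n))"
    then show ?thesis using that[of f] by (simp add: PiE_iff)
  qed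
qed

lemma SG3_interior_Suc:
  "SG3_verts (Suc n) - corners (Suc n) = (\<Union>c\<in>cells. shift (3 ^ n) c ` (SG3_verts n - corners n)) \<union>
     (\<lambda>(i, j). (3 ^ n * i, 3 ^ n * j)) ` {(1, 0), (2, 0), (0, 1), (1, 1), (2, 1), (0, 2), (1, 2)}"
proof -
  have "grid - {(0, 0), (3, 0), (0, 3)} = {(1, 0), (2, 0), (0, 1), (1, 1), (2, 1), (0, 2), (1, 2)}"
    by (simp add: grid_def insert_Diff_if)
  then have grid: "(\<lambda>(i, j). (3 ^ n * i, 3 ^ n * j)) ` grid - corners (Suc n) =
      (\<lambda>(i, j). (3 ^ n * i, 3 ^ n * j)) ` {(1, 0), (2, 0), (0, 1), (1, 1), (2, 1), (0, 2), (1, 2)}"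
    by (simp only: corners_Suc_grid image_set_diff[OF inj_scale, symmetric])
  have "w \<notin> corners (Suc n)" if "w \<in> (\<Union>c\<in>cells. shift (3 ^ n) c ` (SG3_verts n - corners n))"
    for w
    using that unfolding corners_Suc_grid
    by (elim UN_E imageE) (simp only: shift_interior_not_grid not_False_eq_True)
  then have "(\<Union>c\<in>cells. shift (3 ^ n) c ` (SG3_verts n - corners n)) \<inter> corners (Suc n) = {}"
    by blast
  then show ?thesis by (simp only: SG3_verts_Suc Un_Diff grid Diff_triv)
qed

lemma ball_SG3_interior_Suc:
  "(\<forall>v\<in>SG3_verts (Suc n) - corners (Suc n). P v) \<longleftrightarrow>
     (\<forall>c\<in>cells. \<forall>v\<in>SG3_verts n - corners n. P (shift (3 ^ n) c v)) \<and>
     (\<forall>(i, j)\<in>{(1, 0), (2, 0), (0, 1), (1, 1), (2, 1), (0, 2), (1, 2)}. P (3 ^ n * i, 3 ^ n * j))"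
  unfolding SG3_interior_Suc by (simp only: ball_Un ball_UN ball_simps image_iff case_prod_beta)

lemma wdeg_SG3_0:
  assumes "D \<in> orientations (SG3_edges 0)"
  shows "wdeg 1 D (0, 0) = 2" "wdeg 1 D (1, 0) = 2" "wdeg 1 D (0, 1) = 2"
  using assms unfolding orientations_SG3_0
  by (auto simp: wdeg_insert wdeg_empty)

text \<open>A shared point on a side joins two corners of degree 2 and the centre joins three, which
  yields 4 and 6; vertices inside a copy keep their degree. Hence the degree conditions of
  \<open>ice_configs\<close> single out exactly the vertices that are not outmost.\<close>

lemma SG3_total_degrees:
  assumes "D \<in> orientations (SG3_edges n)"
  shows "(\<forall>v\<in>corners n. wdeg 1 D v = 2) \<and> (\<forall>v\<in>SG3_verts n - corners n. wdeg 1 D v \<in> {4, 6})"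
  using assms
proof (induction n arbitrary: D)
  case 0
  then show ?case using wdeg_SG3_0 by (simp add: corners_def)
next
  case (Suc n)
  obtain f where fc: "\<And>c. c \<in> cells \<Longrightarrow> f c \<in> orientations (SG3_edges n)"
    and D: "D = glue cells (shift (3 ^ n)) f"
    using orientations_SucE[OF Suc.prems] by metis
  have corner: "wdeg 1 (f c) (0, 0) = 2" "wdeg 1 (f c) (3 ^ n, 0) = 2" "wdeg 1 (f c) (0, 3 ^ n) = 2"
    if "c \<in> cells" for c
    using Suc.IH[OF fc[OF that]] by (auto simp: corners_def)
  have cells: "(0, 0) \<in> cells" "(1, 0) \<in> cells" "(2, 0) \<in> cells" "(0, 1) \<in> cells"
    "(1, 1) \<in> cells" "(0, 2) \<in> cells" by (simp_all add: cells_eq)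
  note g = wdeg_glue_grid[where f = f and n = n and k = 1, OF fc, simplified corner[OF cells(1)] corner[OF cells(2)]
    corner[OF cells(3)] corner[OF cells(4)] corner[OF cells(5)] corner[OF cells(6)]]
  have "\<forall>v\<in>corners (Suc n). wdeg 1 D v = 2"
    using g unfolding corners_Suc_grid D by simp
  moreover have "\<forall>v\<in>SG3_verts (Suc n) - corners (Suc n). wdeg 1 D v \<in> {4, 6}"
    unfolding ball_SG3_interior_Suc
  proof
    show "\<forall>c\<in>cells. \<forall>v\<in>SG3_verts n - corners n. wdeg 1 D (shift (3 ^ n) c v) \<in> {4, 6}"
      using Suc.IH[OF fc] by (simp add: D wdeg_glue_interior[OF fc])
  qed (use g in \<open>simp add: D\<close>)
  ultimately show ?case by blast
qed

section \<open>Balanced orientations and their boundary states\<close>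

definition balanced :: "nat \<Rightarrow> (point \<times> point) set set" where
  "balanced n = {D \<in> orientations (SG3_edges n). \<forall>v\<in>SG3_verts n - corners n. wdeg (- 1) D v = 0}"

definition flux :: "nat \<Rightarrow> (point \<times> point) set \<Rightarrow> int \<times> int \<times> int" where
  "flux n D = (wdeg (- 1) D (0, 0), wdeg (- 1) D (3 ^ n, 0), wdeg (- 1) D (0, 3 ^ n))"

definition flux_class :: "nat \<Rightarrow> int \<times> int \<times> int \<Rightarrow> (point \<times> point) set set" where
  "flux_class n t = {D \<in> balanced n. flux n D = t}"

definition spins :: "int set" where
  "spins = {- 2, 0, 2}"

definition states :: "(int \<times> int \<times> int) set" where
  "states = {(a, b, c). a \<in> spins \<and> b \<in> spins \<and> c \<in> spins \<and> a + b + c = 0}"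

text \<open>At degree 4 or 6 the ice rule says that indegree and outdegree agree, since their sum is
  the degree; at an outmost vertex, of degree 2, both premises fail.\<close>

lemma ice_configs_eq_balanced: "ice_configs n = balanced n"
proof -
  have "(degree (SG3_edges n) v = 4 \<longrightarrow> in_degree D v = 2 \<and> out_degree D v = 2) \<and>
        (degree (SG3_edges n) v = 6 \<longrightarrow> in_degree D v = 3 \<and> out_degree D v = 3) \<longleftrightarrow>
        (v \<notin> corners n \<longrightarrow> wdeg (- 1) D v = 0)"
    if D: "D \<in> orientations (SG3_edges n)" and v: "v \<in> SG3_verts n" for D v
  proof (cases "v \<in> corners n")
    case True
    then have "wdeg 1 D v = 2" using SG3_total_degrees[OF D] by blast
    then show ?thesis using True degree_eq_in_out[OF simple_SG3_edges D, of v] by (simp add: wdeg_def)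
  next
    case False
    then have "wdeg 1 D v \<in> {4, 6}" using SG3_total_degrees[OF D] v by blast
    then show ?thesis using False degree_eq_in_out[OF simple_SG3_edges D, of v]
      by (auto simp: wdeg_def)
  qed
  then show ?thesis unfolding ice_configs_def balanced_def orientations_def by blast
qed

text \<open>
  The boundary states of the six copies when the whole has state \<open>(a, b, c)\<close>. The free parameters are
  the fluxes \<open>p\<close>, \<open>q\<close>, \<open>r\<close> of the bottom left, bottom right and top copies at their right, top and
  left corner; cancellation at the six shared corners on the sides and the sum zero
  in each copy force the other entries, and cancellation at the centre is then equivalent
  to \<open>a + b + c = 0\<close>.
\<close>

definition cell_state :: "int \<times> int \<times> int \<Rightarrow> int \<times> int \<times> int \<Rightarrow> nat \<times> nat \<Rightarrow> int \<times> int \<times> int" where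
  "cell_state = (\<lambda>(a, b, c) (p, q, r) d.
     if d = (0, 0) then (a, p, - a - p)
     else if d = (2, 0) then (- b - q, b, q)
     else if d = (0, 2) then (r, - c - r, c)
     else if d = (1, 0) then (- p, b + q, p - b - q)
     else if d = (0, 1) then (a + p, r - a - p, - r)
     else (q - c - r, - q, c + r))"

section \<open>Gluing six balanced orientations along their boundary states\<close>

context
  fixes n :: nat
  assumes flux_states: "\<And>D. D \<in> balanced n \<Longrightarrow> flux n D \<in> states"
begin

context
  fixes f :: "nat \<times> nat \<Rightarrow> (point \<times> point) set"
  assumes f: "\<And>c. c \<in> cells \<Longrightarrow> f c \<in> orientations (SG3_edges n)"
begin

private abbreviation (input) "Aa i j \<equiv> wdeg (- 1) (f (i, j)) (0, 0)"
private abbreviation (input) "Bb i j \<equiv> wdeg (- 1) (f (i, j)) (3 ^ n, 0)"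
private abbreviation (input) "Cc i j \<equiv> wdeg (- 1) (f (i, j)) (0, 3 ^ n)"

text \<open>The interior vertices of the next level are those of the copies, where balance is
  inherited, and the seven shared corners: six on the sides with two summands each, and the centre
  with three.\<close>

lemma glue_balanced_iff:
  "glue cells (shift (3 ^ n)) f \<in> balanced (Suc n) \<longleftrightarrow>
     (\<forall>c\<in>cells. f c \<in> balanced n) \<and>
     Bb 0 0 + Aa 1 0 = 0 \<and> Bb 1 0 + Aa 2 0 = 0 \<and>
     Cc 0 0 + Aa 0 1 = 0 \<and> Cc 0 1 + Aa 0 2 = 0 \<and>
     Cc 2 0 + Bb 1 1 = 0 \<and> Cc 1 1 + Bb 0 2 = 0 \<and>
     Cc 1 0 + Bb 0 1 + Aa 1 1 = 0"
proof -
  have "glue cells (shift (3 ^ n)) f \<in> orientations (SG3_edges (Suc n))"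
    using glue_orientation[OF inj_shift disjoint_shifted_edges simple_SG3_edges f] by simp
  then have "glue cells (shift (3 ^ n)) f \<in> balanced (Suc n) \<longleftrightarrow>
      (\<forall>v\<in>SG3_verts (Suc n) - corners (Suc n). wdeg (- 1) (glue cells (shift (3 ^ n)) f) v = 0)"
    by (simp add: balanced_def)
  also have "\<dots> \<longleftrightarrow> (\<forall>c\<in>cells. \<forall>v\<in>SG3_verts n - corners n. wdeg (- 1) (f c) v = 0) \<and>
     (\<forall>(i, j)\<in>{(1, 0), (2, 0), (0, 1), (1, 1), (2, 1), (0, 2), (1, 2)}.
        wdeg (- 1) (glue cells (shift (3 ^ n)) f) (3 ^ n * i, 3 ^ n * j) = 0)"
    unfolding ball_SG3_interior_Suc by (simp only: wdeg_glue_interior[OF f] cong: ball_cong)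
  also have "(\<forall>c\<in>cells. \<forall>v\<in>SG3_verts n - corners n. wdeg (- 1) (f c) v = 0) \<longleftrightarrow>
      (\<forall>c\<in>cells. f c \<in> balanced n)"
    using f by (auto simp: balanced_def)
  also have "(\<forall>(i, j)\<in>{(1, 0), (2, 0), (0, 1), (1, 1), (2, 1), (0, 2), (1, 2)}.
        wdeg (- 1) (glue cells (shift (3 ^ n)) f) (3 ^ n * i, 3 ^ n * j) = 0) \<longleftrightarrow>
     Bb 0 0 + Aa 1 0 = 0 \<and> Bb 1 0 + Aa 2 0 = 0 \<and>
     Cc 0 0 + Aa 0 1 = 0 \<and> Cc 0 1 + Aa 0 2 = 0 \<and>
     Cc 2 0 + Bb 1 1 = 0 \<and> Cc 1 1 + Bb 0 2 = 0 \<and>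
     Cc 1 0 + Bb 0 1 + Aa 1 1 = 0"
    using wdeg_glue_grid[where f = f and n = n and k = "- 1", OF f] by auto
  finally show ?thesis .
qed

lemma flux_glue: "flux (Suc n) (glue cells (shift (3 ^ n)) f) = (Aa 0 0, Bb 2 0, Cc 0 2)"
  using wdeg_glue_grid(1,2,3)[where f = f and n = n and k = "- 1", OF f] by (simp add: flux_def mult.commute)

lemma glue_flux_class_iff:
  assumes t: "t \<in> states"
  shows "glue cells (shift (3 ^ n)) f \<in> flux_class (Suc n) t \<longleftrightarrow>
    (\<exists>u\<in>spins \<times> spins \<times> spins. \<forall>d\<in>cells. f d \<in> flux_class n (cell_state t u d))"
proof -
  obtain a b c where abc: "t = (a, b, c)" "a + b + c = 0" using t by (auto simp: states_def)
  show ?thesis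
  proof
    assume "glue cells (shift (3 ^ n)) f \<in> flux_class (Suc n) t"
    then have bal: "glue cells (shift (3 ^ n)) f \<in> balanced (Suc n)"
      and t': "(Aa 0 0, Bb 2 0, Cc 0 2) = (a, b, c)"
      using abc(1) flux_glue by (auto simp: flux_class_def)
    from bal[unfolded glue_balanced_iff] have fb: "\<And>d. d \<in> cells \<Longrightarrow> f d \<in> balanced n"
      and eqs: "Bb 0 0 + Aa 1 0 = 0" "Bb 1 0 + Aa 2 0 = 0"
     "Cc 0 0 + Aa 0 1 = 0" "Cc 0 1 + Aa 0 2 = 0" "Cc 2 0 + Bb 1 1 = 0" "Cc 1 1 + Bb 0 2 = 0"
     "Cc 1 0 + Bb 0 1 + Aa 1 1 = 0" by auto
    have st: "flux n (f d) \<in> states" if "d \<in> cells" for d using fb[OF that] flux_states by blast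
    have sums: "Aa 0 0 + Bb 0 0 + Cc 0 0 = 0" "Aa 1 0 + Bb 1 0 + Cc 1 0 = 0"
      "Aa 2 0 + Bb 2 0 + Cc 2 0 = 0" "Aa 0 1 + Bb 0 1 + Cc 0 1 = 0"
      "Aa 1 1 + Bb 1 1 + Cc 1 1 = 0" "Aa 0 2 + Bb 0 2 + Cc 0 2 = 0"
      using st[of "(0, 0)"] st[of "(1, 0)"] st[of "(2, 0)"] st[of "(0, 1)"] st[of "(1, 1)"]
        st[of "(0, 2)"] by (simp_all add: flux_def states_def cells_eq)
    have spin: "Bb 0 0 \<in> spins" "Cc 2 0 \<in> spins" "Aa 0 2 \<in> spins"
      using st[of "(0, 0)"] st[of "(2, 0)"] st[of "(0, 2)"]
      by (simp_all add: flux_def states_def cells_eq)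
    \<comment> \<open>The cancellations and the six zero sums are linear equations; solved for the
      remaining entries they give \<open>cell_state\<close>.\<close>
    have "flux n (f d) = cell_state t (Bb 0 0, Cc 2 0, Aa 0 2) d" if "d \<in> cells" for d
      using that eqs sums t' abc unfolding cells_eq cell_state_def flux_def
      by (elim insertE emptyE) simp_all
    then show "\<exists>u\<in>spins \<times> spins \<times> spins. \<forall>d\<in>cells. f d \<in> flux_class n (cell_state t u d)"
      using spin fb by (intro bexI[of _ "(Bb 0 0, Cc 2 0, Aa 0 2)"]) (auto simp: flux_class_def)
  next
    assume "\<exists>u\<in>spins \<times> spins \<times> spins. \<forall>d\<in>cells. f d \<in> flux_class n (cell_state t u d)"
    then obtain p q r where fd: "\<And>d. d \<in> cells \<Longrightarrow> f d \<in> flux_class n (cell_state t (p, q, r) d)"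
      by blast
    then have fb: "\<forall>d\<in>cells. f d \<in> balanced n" by (simp add: flux_class_def)
    have fl: "flux n (f d) = cell_state t (p, q, r) d" if "d \<in> cells" for d
      using fd[OF that] by (simp add: flux_class_def)
    note fls = fl[of "(0, 0)"] fl[of "(1, 0)"] fl[of "(2, 0)"] fl[of "(0, 1)"] fl[of "(1, 1)"]
        fl[of "(0, 2)"]
    \<comment> \<open>Six cancellations are built into \<open>cell_state\<close>; at the centre the
      three entries add up to \<open>- (a + b + c)\<close>, which is 0.\<close>
    show "glue cells (shift (3 ^ n)) f \<in> flux_class (Suc n) t"
      using fb fls abc unfolding flux_class_def mem_Collect_eq glue_balanced_iff flux_glue
      by (simp add: cells_eq cell_state_def flux_def)
  qed
qed

text \<open>Adding the zero sums of the six copies, the fluxes at shared corners cancel and those at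
  the outmost vertices remain. Each of these is a flux of a single corner copy, hence in
  \<open>spins\<close>.\<close>

lemma flux_states_glue:
  assumes "glue cells (shift (3 ^ n)) f \<in> balanced (Suc n)"
  shows "flux (Suc n) (glue cells (shift (3 ^ n)) f) \<in> states"
proof -
  from assms[unfolded glue_balanced_iff] have fb: "\<And>d. d \<in> cells \<Longrightarrow> f d \<in> balanced n"
    and eqs: "Bb 0 0 + Aa 1 0 = 0" "Bb 1 0 + Aa 2 0 = 0"
     "Cc 0 0 + Aa 0 1 = 0" "Cc 0 1 + Aa 0 2 = 0" "Cc 2 0 + Bb 1 1 = 0" "Cc 1 1 + Bb 0 2 = 0"
     "Cc 1 0 + Bb 0 1 + Aa 1 1 = 0" by auto
  have st: "flux n (f d) \<in> states" if "d \<in> cells" for d using fb[OF that] flux_states by blast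
  have "Aa 0 0 + Bb 0 0 + Cc 0 0 = 0" "Aa 1 0 + Bb 1 0 + Cc 1 0 = 0"
      "Aa 2 0 + Bb 2 0 + Cc 2 0 = 0" "Aa 0 1 + Bb 0 1 + Cc 0 1 = 0"
      "Aa 1 1 + Bb 1 1 + Cc 1 1 = 0" "Aa 0 2 + Bb 0 2 + Cc 0 2 = 0"
      "Aa 0 0 \<in> spins" "Bb 2 0 \<in> spins" "Cc 0 2 \<in> spins"
    using st[of "(0, 0)"] st[of "(1, 0)"] st[of "(2, 0)"] st[of "(0, 1)"] st[of "(1, 1)"]
      st[of "(0, 2)"] by (simp_all add: flux_def states_def cells_eq)
  then show ?thesis using eqs unfolding flux_glue states_def by simp
qed

end

lemma flux_states_Suc:
  assumes D: "D \<in> balanced (Suc n)"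
  shows "flux (Suc n) D \<in> states"
proof -
  have "D \<in> orientations (SG3_edges (Suc n))" using D by (simp add: balanced_def)
  then obtain f where f: "\<And>c. c \<in> cells \<Longrightarrow> f c \<in> orientations (SG3_edges n)"
    and Df: "D = glue cells (shift (3 ^ n)) f"
    using orientations_SucE by metis
  show ?thesis using D unfolding Df by (intro flux_states_glue f)
qed

lemma flux_class_Suc:
  assumes t: "t \<in> states"
  shows "flux_class (Suc n) t = glue cells (shift (3 ^ n)) `
    (\<Union>u\<in>spins \<times> spins \<times> spins. PiE cells (\<lambda>d. flux_class n (cell_state t u d)))"
    (is "_ = ?g ` ?U")
proof -
  have sub: "flux_class n s \<subseteq> orientations (SG3_edges n)" for n s
    by (auto simp: flux_class_def balanced_def)
  show ?thesis
  proof (intro equalityI subsetI)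
    fix D assume D: "D \<in> flux_class (Suc n) t"
    then have "D \<in> orientations (SG3_edges (Suc n))" using sub by blast
    then obtain f where ext: "f \<in> extensional cells"
      and fo: "\<And>c. c \<in> cells \<Longrightarrow> f c \<in> orientations (SG3_edges n)" and Df: "D = ?g f"
      using orientations_SucE by metis
    have "?g f \<in> flux_class (Suc n) t \<longleftrightarrow>
        (\<exists>u\<in>spins \<times> spins \<times> spins. \<forall>d\<in>cells. f d \<in> flux_class n (cell_state t u d))"
      by (intro glue_flux_class_iff fo t)
    from this[THEN iffD1, OF D[unfolded Df]] obtain u where u: "u \<in> spins \<times> spins \<times> spins"
      and fd: "\<forall>d\<in>cells. f d \<in> flux_class n (cell_state t u d)" by (rule bexE)
    have "f \<in> PiE cells (\<lambda>d. flux_class n (cell_state t u d))"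
      using fd ext by (simp add: PiE_iff)
    then show "D \<in> ?g ` ?U" using u Df by blast
  next
    fix D assume "D \<in> ?g ` ?U"
    then obtain f u where Df: "D = ?g f" and u: "u \<in> spins \<times> spins \<times> spins"
      and f: "f \<in> PiE cells (\<lambda>d. flux_class n (cell_state t u d))" by blast
    have fd: "f d \<in> flux_class n (cell_state t u d)" if "d \<in> cells" for d using PiE_mem[OF f that] .
    have fo: "f c \<in> orientations (SG3_edges n)" if "c \<in> cells" for c using fd[OF that] sub by blast
    have "?g f \<in> flux_class (Suc n) t \<longleftrightarrow>
        (\<exists>u\<in>spins \<times> spins \<times> spins. \<forall>d\<in>cells. f d \<in> flux_class n (cell_state t u d))"
      by (intro glue_flux_class_iff fo t)
    then show "D \<in> flux_class (Suc n) t" unfolding Df using u fd by blast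
  qed
qed

text \<open>Gluing is injective, so it suffices that different parameters give disjoint families;
  each family is a product over the copies.\<close>

lemma card_flux_class_Suc:
  assumes t: "t \<in> states"
  shows "card (flux_class (Suc n) t) =
    (\<Sum>u\<in>spins \<times> spins \<times> spins. \<Prod>d\<in>cells. card (flux_class n (cell_state t u d)))"
proof -
  let ?F = "\<lambda>u. PiE cells (\<lambda>d. flux_class n (cell_state t u d))"
  have sub: "flux_class n s \<subseteq> orientations (SG3_edges n)" for n s
    by (auto simp: flux_class_def balanced_def)
  have fin: "finite (flux_class n s)" for s
    using finite_subset[OF sub finite_orientations[OF simple_SG3_edges]] .
  have "inj_on (glue cells (shift (3 ^ n))) (\<Union>u\<in>spins \<times> spins \<times> spins. ?F u)"
  proof (rule inj_on_subset[OF bij_betw_imp_inj_on[OF glue_orientations_Suc]])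
    show "(\<Union>u\<in>spins \<times> spins \<times> spins. ?F u) \<subseteq> PiE cells (\<lambda>_. orientations (SG3_edges n))"
      by (intro UN_least PiE_mono sub)
  qed
  then have "card (flux_class (Suc n) t) = card (\<Union>u\<in>spins \<times> spins \<times> spins. ?F u)"
    unfolding flux_class_Suc[OF t] by (rule card_image)
  also have "\<dots> = (\<Sum>u\<in>spins \<times> spins \<times> spins. card (?F u))"
  proof (rule card_UN_disjoint)
    show "\<forall>u\<in>spins \<times> spins \<times> spins. finite (?F u)"
      by (intro ballI finite_PiE finite_cells fin)
    show "\<forall>u\<in>spins \<times> spins \<times> spins. \<forall>u'\<in>spins \<times> spins \<times> spins. u \<noteq> u' \<longrightarrow> ?F u \<inter> ?F u' = {}"
    proof (intro ballI impI, rule ccontr)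
      fix u u' assume "u \<noteq> u'" "?F u \<inter> ?F u' \<noteq> {}"
      then obtain f where f: "f \<in> ?F u" "f \<in> ?F u'" by blast
      have eq: "cell_state t u d = cell_state t u' d" if "d \<in> cells" for d
        using PiE_mem[OF f(1) that] PiE_mem[OF f(2) that] by (simp add: flux_class_def)
      \<comment> \<open>The parameters occur as entries in the states of the three corner copies, so
        equal states force \<open>u = u'\<close>.\<close>
      show False using eq[of "(0, 0)"] eq[of "(2, 0)"] eq[of "(0, 2)"] \<open>u \<noteq> u'\<close>
        by (auto simp: cells_eq cell_state_def split: prod.splits)
    qed
  qed (simp add: spins_def)
  also have "\<dots> = (\<Sum>u\<in>spins \<times> spins \<times> spins. \<Prod>d\<in>cells. card (flux_class n (cell_state t u d)))"
    by (intro sum.cong refl card_PiE finite_cells)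
  finally show ?thesis .
qed

end

section \<open>The recursion for the number of configurations\<close>

lemma states_eq:
  "states = {(0, 0, 0), (- 2, 0, 2), (- 2, 2, 0), (0, - 2, 2), (0, 2, - 2), (2, - 2, 0), (2, 0, - 2)}"
proof (intro equalityI subsetI)
  fix t assume "t \<in> states"
  then obtain a b c where "t = (a, b, c)" "a + b + c = 0" "a \<in> {- 2, 0, 2}" "b \<in> {- 2, 0, 2}"
      "c \<in> {- 2, 0, 2}"
    by (auto simp: states_def spins_def)
  then show "t \<in> {(0, 0, 0), (- 2, 0, 2), (- 2, 2, 0), (0, - 2, 2), (0, 2, - 2), (2, - 2, 0), (2, 0, - 2)}"
    by (elim insertE emptyE) simp_all
qed (auto simp: states_def spins_def)

text \<open>The value 0 outside \<open>states\<close> discards parameters that would force an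
  impossible boundary state on some copy.\<close>

definition weight :: "nat \<Rightarrow> nat \<Rightarrow> int \<times> int \<times> int \<Rightarrow> nat" where
  "weight x y t = (if t = (0, 0, 0) then x else if t \<in> states then y else 0)"

lemma weight_eq:
  "weight x y (a, b, c) = (if a = 0 \<and> b = 0 \<and> c = 0 then x
     else if a \<in> spins \<and> b \<in> spins \<and> c \<in> spins \<and> a + b + c = 0 then y else 0)"
  by (simp add: weight_def states_def)

text \<open>\<open>x\<close> and \<open>y\<close> are the numbers of configurations with boundary state \<open>(0, 0, 0)\<close> and with any fixed
  other state.\<close>

definition flat :: "nat \<Rightarrow> nat \<Rightarrow> nat" where
  "flat x y = x ^ 6 + 6 * x ^ 3 * y ^ 3 + 6 * x * y ^ 5 + 2 * y ^ 6"

definition tilted :: "nat \<Rightarrow> nat \<Rightarrow> nat" where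
  "tilted x y = x ^ 3 * y ^ 3 + 3 * x ^ 2 * y ^ 4 + x * y ^ 5 + 4 * y ^ 6"

text \<open>For each of the seven states the 27 products are evaluated outright. At
  \<open>x = y = 1\<close> the polynomials count the contributing triples: 15 for the zero state, 9
  for any other. That the six others agree reflects the symmetries of the triangle, which permute
  them.\<close>

lemma sum_weight_cell_states:
  assumes "t \<in> states"
  shows "(\<Sum>u\<in>spins \<times> spins \<times> spins. \<Prod>d\<in>cells. weight x y (cell_state t u d)) =
    weight (flat x y) (tilted x y) t"
  using assms unfolding states_eq
  by (elim insertE emptyE)
     (simp_all add: sum.cartesian_product' cells_eq cell_state_def weight_eq spins_def flat_def tilted_def
        power_numeral_reduce algebra_simps)

lemma flux_class_0:
  assumes "t \<in> states"
  shows "card (flux_class 0 t) = weight 2 1 t"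
proof -
  have "balanced 0 = orientations (SG3_edges 0)"
    by (simp add: balanced_def corners_def)
  then have "flux_class 0 t = orientations (SG3_edges 0) \<inter> {D. flux 0 D = t}"
    by (auto simp: flux_class_def)
  \<comment> \<open>These are the two cyclic orientations, the only ones of state
    \<open>(0, 0, 0)\<close>; the count 2 rests on their being distinct.\<close>
  moreover have "{((1, 0), (0, 0)), ((0, 1), (1, 0)), ((0, 0), (0, 1))} \<noteq>
      ({((0, 0), (1, 0)), ((1, 0), (0, 1)), ((0, 1), (0, 0))} :: (point \<times> point) set)" (is "?L \<noteq> ?R")
  proof -
    have "((1, 0), (0, 0)) \<in> ?L" "((1, 0), (0, 0)) \<notin> ?R" by simp_all
    then show ?thesis by (metis (no_types))
  qed
  ultimately show ?thesis
    using assms unfolding states_eq orientations_SG3_0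
    by (elim insertE emptyE)
       (simp_all add: weight_eq spins_def flux_def insert_Times_insert wdeg_insert wdeg_empty
         Int_insert_left doubleton_eq_iff insert_eq_iff)
qed

lemma flux_states_0:
  assumes "D \<in> balanced 0"
  shows "flux 0 D \<in> states"
  using assms unfolding balanced_def orientations_SG3_0
  by (auto simp: flux_def states_def spins_def wdeg_insert wdeg_empty)

primrec ice_pair :: "nat \<Rightarrow> nat \<times> nat" where
  "ice_pair 0 = (2, 1)"
| "ice_pair (Suc n) = (flat (fst (ice_pair n)) (snd (ice_pair n)),
     tilted (fst (ice_pair n)) (snd (ice_pair n)))"

text \<open>Induction discharges the assumption of the gluing context, which is this claim at level
  \<open>n\<close>.\<close>

lemma flux_states: "D \<in> balanced n \<Longrightarrow> flux n D \<in> states"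
  by (induction n arbitrary: D) (simp_all add: flux_states_0 flux_states_Suc)

lemma card_flux_class: "card (flux_class n t) = weight (fst (ice_pair n)) (snd (ice_pair n)) t"
proof (cases "t \<in> states")
  case True
  then show ?thesis
  proof (induction n arbitrary: t)
    case (Suc n)
    \<comment> \<open>The induction hypothesis covers only \<open>states\<close>, but the sum also
      meets other triples; there both sides vanish.\<close>
    have "card (flux_class n s) = weight (fst (ice_pair n)) (snd (ice_pair n)) s" for s
    proof (cases "s \<in> states")
      case False
      then have "flux_class n s = {}" using flux_states by (auto simp: flux_class_def)
      moreover have "s \<noteq> (0, 0, 0)" using False by (auto simp: states_eq)
      ultimately show ?thesis using False by (simp add: weight_def)
    qed (rule Suc.IH)
    then show ?case
      using card_flux_class_Suc[OF flux_states Suc.prems] sum_weight_cell_states[OF Suc.prems]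
      by simp
  qed (simp add: flux_class_0)
next
  case False
  then have "flux_class n t = {}" using flux_states by (auto simp: flux_class_def)
  moreover have "t \<noteq> (0, 0, 0)" using False by (auto simp: states_eq)
  ultimately show ?thesis using False by (simp add: weight_def)
qed

lemma I3_eq: "I3 n = fst (ice_pair n) + 6 * snd (ice_pair n)"
proof -
  have "finite (balanced n)"
    by (rule finite_subset[OF _ finite_orientations[OF simple_SG3_edges]]) (auto simp: balanced_def)
  then have fin: "finite (flux_class n t)" for t by (simp add: flux_class_def)
  have "balanced n = (\<Union>t\<in>states. flux_class n t)"
    using flux_states by (auto simp: flux_class_def)
  then have "I3 n = card (\<Union>t\<in>states. flux_class n t)"
    by (simp add: I3_def ice_configs_eq_balanced)
  also have "\<dots> = (\<Sum>t\<in>states. card (flux_class n t))"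
    by (rule card_UN_disjoint) (use fin in \<open>auto simp: flux_class_def states_eq\<close>)
  also have "\<dots> = fst (ice_pair n) + 6 * snd (ice_pair n)"
    unfolding card_flux_class by (simp add: states_eq weight_eq spins_def)
  finally show ?thesis .
qed

section \<open>Growth rate\<close>

text \<open>The partial sums are those of \<open>2 artanh y\<close>, with a geometric bound for the
  tail. An argument \<open>a / b\<close> is reached with \<open>y = (a - b) / (a + b)\<close>: 1/3
  for 2 and 13/59 for 36/23.\<close>

lemma ln_artanh_bounds:
  fixes y :: real and n :: nat
  assumes "0 < y" "y < 1"
  defines "s \<equiv> \<Sum>k<n. 2 * y ^ (2 * k + 1) / of_nat (2 * k + 1)"
  shows "s \<le> ln ((1 + y) / (1 - y))"
    and "ln ((1 + y) / (1 - y)) \<le> s + 2 * (y ^ (2 * n + 1) / (1 - y ^ 2) / of_nat (2 * n + 1))"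
proof -
  have "((1 + y) / (1 - y) - 1) / ((1 + y) / (1 - y) + 1) = y" "(1 + y) / (1 - y) > 1"
    using assms by (simp_all add: field_simps)
  then show "s \<le> ln ((1 + y) / (1 - y))"
    and "ln ((1 + y) / (1 - y)) \<le> s + 2 * (y ^ (2 * n + 1) / (1 - y ^ 2) / of_nat (2 * n + 1))"
    using ln_approx_bounds[of "(1 + y) / (1 - y)" n] unfolding s_def by simp_all
qed

lemma ln_2_bounds:
  "69314718055994530 / 10 ^ 17 \<le> ln (2::real)" "ln (2::real) \<le> 69314718055994532 / 10 ^ 17"
  using ln_artanh_bounds[of "1/3" 17] by (simp_all add: lessThan_nat_numeral lessThan_Suc power_divide)

lemma ln_36_23_bounds:
  "44802472252692 / 10 ^ 14 \<le> ln (36 / 23 :: real)" "ln (36 / 23 :: real) \<le> 44802472252698 / 10 ^ 14"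
  using ln_artanh_bounds[of "13/59" 9] by (simp_all add: lessThan_nat_numeral lessThan_Suc power_divide)

text \<open>
  The value of \<open>x\<close> on level 3 exceeds \<open>2^251 * (36 / 23) * correction\<close> by a relative error of about
  \<open>10^-13\<close>; here \<open>36 / 23\<close> is a convergent of the continued fraction of \<open>x / 2^251\<close>, which makes the
  logarithms of both factors cheap to bound by the series of artanh.
\<close>

definition correction :: real where
  "correction = (1 + 548909503 / 10 ^ 13) / (1 - 548909503 / 10 ^ 13)"

lemma ln_correction_bounds:
  "1097819007 / 10 ^ 13 \<le> ln correction" "ln correction \<le> 1097819008 / 10 ^ 13"
  using ln_artanh_bounds[of "548909503 / 10 ^ 13" 2] unfolding correction_def
  by (simp_all add: lessThan_nat_numeral lessThan_Suc power_divide)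

section \<open>Comparison of the two counts\<close>

lemma ice_pair_pos: "0 < fst (ice_pair n) \<and> 0 < snd (ice_pair n)"
  by (induction n) (simp_all add: flat_def tilted_def)

text \<open>The term \<open>6 * x ^ 3 * y ^ 3\<close> of \<open>flat\<close> is exactly used up: it
  absorbs \<open>x ^ 3 * y ^ 3\<close>, \<open>3 * x ^ 2 * y ^ 4\<close> and half of
  \<open>4 * y ^ 6\<close>.\<close>

lemma tilted_le_flat:
  assumes "y \<le> x"
  shows "tilted x y \<le> flat x y"
proof -
  have "x ^ 2 * y ^ 4 \<le> x ^ 3 * y ^ 3" using mult_le_mono2[OF assms, of "x ^ 2 * y ^ 3"]
    by (simp add: power_numeral_reduce ac_simps)
  moreover have "y ^ 6 \<le> x ^ 3 * y ^ 3" using mult_le_mono1[OF power_mono[OF assms, of 3], of "y ^ 3"]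
    by (simp add: power_numeral_reduce ac_simps)
  ultimately show ?thesis unfolding tilted_def flat_def by linarith
qed

lemma ice_pair_le: "snd (ice_pair n) \<le> fst (ice_pair n)"
  by (induction n) (simp_all add: tilted_le_flat)

text \<open>A monomial with \<open>y ^ j\<close> is at most \<open>x ^ 6 / 300000 ^ j\<close>, so
  the main excess \<open>6 * x ^ 3 * y ^ 3\<close> is below \<open>10^-15 * x ^ 6\<close>. The ratio
  bound reproduces itself with a wide margin; 300000 is a round number below the ratio at level 3,
  about 340000.\<close>

lemma tilted_flat_bounds:
  fixes x y :: nat
  assumes "300000 * y \<le> x"
  shows "300000 * tilted x y \<le> flat x y" "10 ^ 15 * flat x y \<le> (10 ^ 15 + 1) * x ^ 6"
proof -
  let ?k = "300000 :: nat"
  have y: "?k ^ j * (x ^ (6 - j) * y ^ j) \<le> x ^ 6" if "j \<le> 6" for j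
  proof -
    have "(?k * y) ^ j * x ^ (6 - j) \<le> x ^ j * x ^ (6 - j)"
      using assms by (intro mult_le_mono1 power_mono) simp_all
    also have "\<dots> = x ^ 6" using that by (simp flip: power_add)
    finally show ?thesis by (simp add: power_mult_distrib ac_simps)
  qed
  show "300000 * tilted x y \<le> flat x y" "10 ^ 15 * flat x y \<le> (10 ^ 15 + 1) * x ^ 6"
    using y[of 3] y[of 4] y[of 5] y[of 6] unfolding tilted_def flat_def by simp_all
qed

text \<open>Level 3 is the first one precise enough: at level 2 the ratio of the counts is only
  about 70, and the step from there still has a relative excess of order
  \<open>10^-5\<close>.\<close>

lemma ice_pair_3:
  "ice_pair 3 = (5664365305961286971586456907453366875508068472044611641985239744461869678592,
     16659267465184702360405178241811671697861664563630761252887929787777024)"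
  by (simp add: numeral_3_eq_3 flat_def tilted_def)

lemma ice_pair_ratio:
  assumes "3 \<le> n"
  shows "300000 * snd (ice_pair n) \<le> fst (ice_pair n)"
  using assms
proof (induction n rule: dec_induct)
  case base
  then show ?case by (simp add: ice_pair_3)
next
  case (step n)
  then show ?case using tilted_flat_bounds(1) by simp
qed

section \<open>Convergence of the rate and its value\<close>

definition log_rate :: "nat \<Rightarrow> real" where
  "log_rate n = ln (real (fst (ice_pair n))) / 6 ^ n"

lemma incseq_log_rate: "incseq log_rate"
proof (rule incseq_SucI)
  fix n
  let ?x = "fst (ice_pair n)"
  have "real ?x ^ 6 \<le> real (fst (ice_pair (Suc n)))"
    by (simp add: flat_def flip: of_nat_power)
  then have "ln (real ?x ^ 6) \<le> ln (real (fst (ice_pair (Suc n))))"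
    using ice_pair_pos[of n] by (intro ln_mono) simp_all
  then show "log_rate n \<le> log_rate (Suc n)"
    using ice_pair_pos[of n] by (simp add: log_rate_def ln_realpow field_simps del: ice_pair.simps)
qed

lemma log_rate_Suc_le:
  assumes "3 \<le> n"
  shows "log_rate (Suc n) \<le> log_rate n + 1 / 10 ^ 15 / 6 ^ Suc n"
proof -
  let ?x = "fst (ice_pair n)"
  have "10 ^ 15 * fst (ice_pair (Suc n)) \<le> (10 ^ 15 + 1) * ?x ^ 6"
    using tilted_flat_bounds(2)[OF ice_pair_ratio[OF assms]] by simp
  then have "real (10 ^ 15 * fst (ice_pair (Suc n))) \<le> real ((10 ^ 15 + 1) * ?x ^ 6)"
    by (simp only: of_nat_le_iff)
  then have "real (fst (ice_pair (Suc n))) \<le> (1 + 1 / 10 ^ 15) * real ?x ^ 6"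
    by (simp del: ice_pair.simps)
  then have "ln (real (fst (ice_pair (Suc n)))) \<le> ln ((1 + 1 / 10 ^ 15) * real ?x ^ 6)"
    using ice_pair_pos[of "Suc n"] by (intro ln_mono) (simp_all del: ice_pair.simps)
  also have "\<dots> = ln (1 + 1 / 10 ^ 15) + 6 * ln (real ?x)"
    using ice_pair_pos[of n] by (subst ln_mult_pos) (simp_all add: ln_realpow)
  also have "ln (1 + 1 / 10 ^ 15 :: real) \<le> 1 / 10 ^ 15" by (rule ln_add_one_self_le_self) simp
  finally have "ln (real (fst (ice_pair (Suc n)))) \<le> 1 / 10 ^ 15 + 6 * ln (real ?x)" by simp
  then have "ln (real (fst (ice_pair (Suc n)))) / 6 ^ Suc n \<le> (1 / 10 ^ 15 + 6 * ln (real ?x)) / 6 ^ Suc n"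
    by (rule divide_right_mono) simp
  then show ?thesis unfolding log_rate_def by (simp add: add_divide_distrib del: ice_pair.simps)
qed

lemma log_rate_le: "log_rate n \<le> log_rate 3 + 1 / 10 ^ 15 / 6 ^ 3"
proof (cases "3 \<le> n")
  case True
  \<comment> \<open>The extra term on the left makes the induction work: it drops by a factor of 6
    in each step, which pays for the increment allowed by \<open>log_rate_Suc_le\<close>.\<close>
  have "log_rate n + 1 / 10 ^ 15 / 6 ^ n \<le> log_rate 3 + 1 / 10 ^ 15 / 6 ^ 3"
    using True
  proof (induction n rule: dec_induct)
    case (step n)
    have "2 * (1 / 10 ^ 15 / 6 ^ Suc n) \<le> 1 / 10 ^ 15 / (6 :: real) ^ n" by (simp add: field_simps)
    then show ?case using step log_rate_Suc_le[OF step(1)] by linarith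
  qed simp
  moreover have "0 \<le> 1 / 10 ^ 15 / (6 :: real) ^ n" by simp
  ultimately show ?thesis by linarith
next
  case False
  then have "log_rate n \<le> log_rate 3" by (intro incseqD[OF incseq_log_rate]) simp
  moreover have "0 \<le> 1 / 10 ^ 15 / (6 :: real) ^ 3" by simp
  ultimately show ?thesis by linarith
qed

lemma log_rate_3_bounds:
  "7 / 5 * 0.576812423363 \<le> log_rate 3"
  "log_rate 3 + 1 / 10 ^ 15 / 6 ^ 3 < 7 / 5 * 0.576812423364"
proof -
  let ?x = "5664365305961286971586456907453366875508068472044611641985239744461869678592 :: real"
  let ?m = "2 ^ 251 * (36 / 23 * correction)"
  have correction: "correction > 0" by (simp add: correction_def)
  have "ln ?m = ln (2 ^ 251) + ln (36 / 23 * correction)"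
    by (rule ln_mult_pos) (use correction in simp_all)
  also have "ln (36 / 23 * correction) = ln (36 / 23) + ln correction"
    by (rule ln_mult_pos) (use correction in simp_all)
  finally have ln: "ln ?m = 251 * ln 2 + (ln (36 / 23) + ln correction)"
    by (simp only: ln_realpow of_nat_numeral)
  \<comment> \<open>The lower bound is the delicate one: the target leaves a margin of about
    \<open>3 / 10 ^ 12\<close> in \<open>ln ?x\<close>, which dictates the accuracy of
    \<open>correction\<close>.\<close>
  have "ln ?m \<le> ln ?x"
    by (rule ln_mono) (simp_all add: correction_def)
  then have lower: "251 * ln 2 + (ln (36 / 23) + ln correction) \<le> ln ?x" unfolding ln .
  \<comment> \<open>The upper bound leaves about \<open>3 / 10 ^ 10\<close> in \<open>ln ?x\<close>,
    so the crude factor \<open>1 + 1 / 10 ^ 10\<close> is enough.\<close>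
  have "ln ?x \<le> ln ((1 + 1 / 10 ^ 10) * ?m)"
    by (rule ln_mono) (simp_all add: correction_def)
  also have "\<dots> = ln (1 + 1 / 10 ^ 10) + ln ?m"
    by (rule ln_mult_pos) (simp_all add: correction_def)
  also have "ln (1 + 1 / 10 ^ 10 :: real) \<le> 1 / 10 ^ 10" by (rule ln_add_one_self_le_self) simp
  finally have upper: "ln ?x \<le> 1 / 10 ^ 10 + (251 * ln 2 + (ln (36 / 23) + ln correction))"
    unfolding ln by simp
  have rate: "log_rate 3 = ln ?x / 216" by (simp add: log_rate_def ice_pair_3)
  show "7 / 5 * 0.576812423363 \<le> log_rate 3"
    using lower ln_2_bounds(1) ln_36_23_bounds(1) ln_correction_bounds(1) unfolding rate by simp
  show "log_rate 3 + 1 / 10 ^ 15 / 6 ^ 3 < 7 / 5 * 0.576812423364"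
    using upper ln_2_bounds(2) ln_36_23_bounds(2) ln_correction_bounds(2) unfolding rate by simp
qed

lemma tendsto_over_6_power: "(\<lambda>n. c / 6 ^ n) \<longlonglongrightarrow> (0 :: real)"
proof -
  have "(\<lambda>n. c * (1 / 6) ^ n) \<longlonglongrightarrow> c * 0"
    by (intro tendsto_mult tendsto_const LIMSEQ_power_zero) simp
  then show ?thesis by (simp add: power_one_over)
qed

theorem proposition5p1:
  shows "(\<forall>n. real (card (SG3_verts n)) = (7 * 6 ^ n + 8) / 5) \<and>
    (\<exists>S::real.
       (\<lambda>n. ln (real (I3 n)) / real (card (SG3_verts n))) \<longlonglongrightarrow> S \<and>
       0.576812423363 \<le> S \<and> S < 0.576812423364)"
proof
  show "\<forall>n. real (card (SG3_verts n)) = (7 * 6 ^ n + 8) / 5" using card_SG3_verts by blast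
  obtain L where L: "log_rate \<longlonglongrightarrow> L" and ge: "\<And>n. log_rate n \<le> L"
    using incseq_convergent[OF incseq_log_rate] log_rate_le by blast
  have le: "L \<le> log_rate 3 + 1 / 10 ^ 15 / 6 ^ 3"
    using LIMSEQ_le_const2[OF L] log_rate_le by blast
  \<comment> \<open>The error of replacing \<open>I3 n\<close> by the count \<open>x\<close> of the
    zero state: from \<open>x \<le> I3 n \<le> 7 * x\<close> it is at most
    \<open>ln 7 / 6 ^ n\<close>.\<close>
  define e where "e n = ln (real (I3 n)) / 6 ^ n - log_rate n" for n
  have e: "0 \<le> e n" "e n \<le> ln 7 / 6 ^ n" for n
  proof -
    let ?x = "real (fst (ice_pair n))"
    have "?x \<le> real (I3 n)" "real (I3 n) \<le> 7 * ?x" "0 < ?x"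
      using ice_pair_le[of n] ice_pair_pos[of n] by (simp_all add: I3_eq)
    then have "ln ?x \<le> ln (real (I3 n))" "ln (real (I3 n)) \<le> ln (7 * ?x)"
      by (intro ln_mono; linarith)+
    moreover have "ln (7 * ?x) = ln 7 + ln ?x" using \<open>0 < ?x\<close> by (subst ln_mult_pos) simp_all
    ultimately show "0 \<le> e n" "e n \<le> ln 7 / 6 ^ n"
      unfolding e_def log_rate_def diff_divide_distrib[symmetric]
      by (simp_all add: divide_right_mono)
  qed
  have "e \<longlonglongrightarrow> 0"
    by (rule tendsto_sandwich[OF _ _ tendsto_const tendsto_over_6_power[of "ln 7"]])
       (use e in \<open>simp_all add: always_eventually\<close>)
  then have num: "(\<lambda>n. log_rate n + e n) \<longlonglongrightarrow> L" using tendsto_add[OF L, of e 0] by simp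
  \<comment> \<open>Numerator and denominator of the entropy quotient are both divided by
    \<open>6 ^ n\<close>, so each has a finite nonzero limit.\<close>
  have den: "(\<lambda>n. (7 + 8 / 6 ^ n) / 5 :: real) \<longlonglongrightarrow> 7 / 5"
    by (rule tendsto_eq_intros tendsto_over_6_power refl)+ simp_all
  have "(\<lambda>n. (log_rate n + e n) / ((7 + 8 / 6 ^ n) / 5)) \<longlonglongrightarrow> L / (7 / 5)"
    by (rule tendsto_divide[OF num den]) simp
  moreover have "(log_rate n + e n) / ((7 + 8 / 6 ^ n) / 5) = ln (real (I3 n)) / real (card (SG3_verts n))" for n
    unfolding e_def card_SG3_verts by (simp add: field_simps)
  ultimately have "(\<lambda>n. ln (real (I3 n)) / real (card (SG3_verts n))) \<longlonglongrightarrow> L / (7 / 5)"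
    by simp
  moreover have "0.576812423363 \<le> L / (7 / 5)" "L / (7 / 5) < 0.576812423364"
    using ge[of 3] le log_rate_3_bounds by simp_all
  ultimately show "\<exists>S::real.
       (\<lambda>n. ln (real (I3 n)) / real (card (SG3_verts n))) \<longlonglongrightarrow> S \<and>
       0.576812423363 \<le> S \<and> S < 0.576812423364" by blast
qed

end
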